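(* Let $\mathcal{A}$ and $\mathcal{B}$ be $\mathbb{Z}_2$-graded sets which are at most countable and let $d\ge1$. For every $\lambda\in\mathbb{Z}^d_+$, $$S^{\mathcal{A}/\mathcal{B}}_{\lambda}=\det\big(h^{\mathcal{A}/\mathcal{B}}_{\lambda_i-i+j}\big)_{1\le i,j\le d}.$$
   Context: Super Schur functions: for a $\mathbb{Z}_2$-graded set $\mathcal{A}=\mathcal{A}_0\sqcup\mathcal{A}_1$ (at most countable) with variables $\mathbf{x}_{\mathcal{A}}=\{x_a\}$, $S_{\lambda/\mu}(\mathbf{x}_{\mathcal{A}})=\sum_{\mu\subset\nu\subset\lambda}s_{\nu/\mu}(\mathbf{x}_{\mathcal{A}_0})\,s_{\lambda'/\nu'}(\mathbf{x}_{\mathcal{A}_1})$ ($s$ = skew Schur function, $'$ = conjugate), and similarly $S_{\lambda/\mu}(\mathbf{x}^{-1}_{\mathcal{B}})$ in the variables $x_b^{-1}$. $\mathbb{Z}^d_+=\{\lambda\in\mathbb{Z}^d\mid\lambda_1\ge\cdots\ge\lambda_d\}$, $(p^d)=(p,\ldots,p)$. $S^{\mathcal{A}/\mathcal{B}}_\lambda=\sum S_{(\lambda+(p^d))/\eta}(\mathbf{x}_{\mathcal{A}})\,S_{(p^d)/\eta}(\mathbf{x}_{\mathcal{B}}^{-1})$, summed over pairs of skew diagrams $((\lambda+(p^d))/\eta,(p^d)/\eta)$ with $p\ge0$, $\lambda+(p^d)$ a partition, $\eta\subset\lambda+(p^d),(p^d)$, where $(p,\eta)$ and $(p+1,\eta+(1^d))$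 give the same pair and are counted once; i.e. one term for each $\kappa=\eta-(p^d)\in\mathbb{Z}^d_+$ with $\kappa_i\le\min(\lambda_i,0)$ for all $i$. The elements $h^{\mathcal{A}/\mathcal{B}}_k$ ($k\in\mathbb{Z}$) are defined by $$\frac{\prod_{a\in\mathcal{A}_1}(1+x_at)\prod_{b\in\mathcal{B}_1}(1+x_b^{-1}t^{-1})}{\prod_{a\in\mathcal{A}_0}(1-x_at)\prod_{b\in\mathcal{B}_0}(1-x_b^{-1}t^{-1})}=\sum_{k\in\mathbb{Z}}h^{\mathcal{A}/\mathcal{B}}_kt^k,$$ equivalently $h^{\mathcal{A}/\mathcal{B}}_k=\sum_{m-n=k}S_{(m)}(\mathbf{x}_{\mathcal{A}})S_{(n)}(\mathbf{x}^{-1}_{\mathcal{B}})$ over $m,n\ge0$. The $x_a$ and $x_b^{-1}$ are independent variables and everything is in formal power series in them. *)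

theory Defs
  imports
    "HOL-Library.Multiset"
    "HOL-Library.FuncSet"
    "HOL-Library.Countable_Set"
    "HOL-Computational_Algebra.Formal_Laurent_Series"
    "Jordan_Normal_Form.Determinant"
begin

section \<open>Formal power series in arbitrarily many variables\<close>

text \<open>
  A monomial in variables of type \<open>'v\<close> is a finite multiset; a power series is an arbitrary
  assignment of coefficients to monomials.
\<close>

typedef ('v, 'c) mps = "UNIV :: ('v multiset \<Rightarrow> 'c) set"
  morphisms mps_coeff Abs_mps by simp

setup_lifting type_definition_mps

lemma mps_eqI: "(\<And>m. mps_coeff f m = mps_coeff g m) \<Longrightarrow> f = g"
  by (metis ext mps_coeff_inject)

lemma finite_submultisets: "finite {k. k \<subseteq># m}"
proof (induction m)
  case empty
  then show ?case by simp
next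
  case (add x m)
  have "k \<in> {k. k \<subseteq># m} \<union> add_mset x ` {k. k \<subseteq># m}" if k: "k \<subseteq># add_mset x m" for k
  proof (cases "x \<in># k")
    case True
    then obtain k' where "k = add_mset x k'" by (metis mset_add)
    then show ?thesis using k by auto
  next
    case False
    then have "count k y \<le> count m y" for y
      using k mset_subset_eq_count[OF k, of y] by (cases "y = x") (auto simp: not_in_iff)
    then show ?thesis by (simp add: subseteq_mset_def)
  qed
  then have "{k. k \<subseteq># add_mset x m} \<subseteq> {k. k \<subseteq># m} \<union> add_mset x ` {k. k \<subseteq># m}" by blast
  then show ?case using add finite_subset by blast
qed

instantiation mps :: (type, comm_ring_1) comm_ring_1
begin

lift_definition zero_mps :: "('a, 'b) mps" is "\<lambda>_. 0" .
lift_definition one_mps :: "('a, 'b) mps" is "\<lambda>m. if m = {#} then 1 else 0" .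
lift_definition plus_mps :: "('a, 'b) mps \<Rightarrow> ('a, 'b) mps \<Rightarrow> ('a, 'b) mps"
  is "\<lambda>f g m. f m + g m" .
lift_definition minus_mps :: "('a, 'b) mps \<Rightarrow> ('a, 'b) mps \<Rightarrow> ('a, 'b) mps"
  is "\<lambda>f g m. f m - g m" .
lift_definition uminus_mps :: "('a, 'b) mps \<Rightarrow> ('a, 'b) mps"
  is "\<lambda>f m. - f m" .
lift_definition times_mps :: "('a, 'b) mps \<Rightarrow> ('a, 'b) mps \<Rightarrow> ('a, 'b) mps"
  is "\<lambda>f g m. \<Sum>k | k \<subseteq># m. f k * g (m - k)" .

instance
proof
  fix f g h :: "('a, 'b) mps"
  show "f + g + h = f + (g + h)" by transfer (simp add: add.assoc)
  show "f + g = g + f" by transfer (simp add: add.commute)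
  show "0 + f = f" by transfer simp
  show "- f + f = 0" by transfer simp
  show "f - g = f + - g" by transfer simp
  show "(0 :: ('a, 'b) mps) \<noteq> 1" by transfer (metis zero_neq_one)
  show "(f + g) * h = f * h + g * h"
    by transfer (simp add: distrib_right sum.distrib)
  show "1 * f = f"
  proof (transfer, rule ext)
    fix f :: "'a multiset \<Rightarrow> 'b" and m :: "'a multiset"
    have "(\<Sum>k | k \<subseteq># m. (if k = {#} then 1 else 0) * f (m - k))
        = (\<Sum>k | k \<subseteq># m. if k = {#} then f m else 0)"
      by (rule sum.cong) auto
    also have "\<dots> = f m"
      using finite_submultisets[of m] by (subst sum.delta) auto
    finally show "(\<Sum>k | k \<subseteq># m. (if k = {#} then 1 else 0) * f (m - k)) = f m" .
  qed
  show "f * g = g * f"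
  proof (transfer, rule ext)
    fix f g :: "'a multiset \<Rightarrow> 'b" and m :: "'a multiset"
    show "(\<Sum>k | k \<subseteq># m. f k * g (m - k)) = (\<Sum>k | k \<subseteq># m. g k * f (m - k))"
      by (rule sum.reindex_bij_witness[of _ "\<lambda>k. m - k" "\<lambda>k. m - k"])
         (auto simp: multiset_diff_union_assoc subset_mset.diff_diff_right mult.commute)
  qed
  show "f * g * h = f * (g * h)"
  proof (transfer, rule ext)
    fix f g h :: "'a multiset \<Rightarrow> 'b" and m :: "'a multiset"
    have "(\<Sum>k | k \<subseteq># m. (\<Sum>l | l \<subseteq># k. f l * g (k - l)) * h (m - k))
        = (\<Sum>(k, l)\<in>(SIGMA k:{k. k \<subseteq># m}. {l. l \<subseteq># k}). f l * g (k - l) * h (m - k))"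
      by (simp add: sum_distrib_right sum.Sigma finite_submultisets)
    also have "\<dots> = (\<Sum>(l, n)\<in>(SIGMA l:{l. l \<subseteq># m}. {n. n \<subseteq># m - l}).
        f l * (g n * h (m - l - n)))"
    proof (rule sum.reindex_bij_witness[of _ "\<lambda>(l, n). (l + n, l)" "\<lambda>(k, l). (l, k - l)"], goal_cases)
      case (1 a)
      then show ?case by auto
    next
      case (2 a)
      then show ?case
        by (auto simp: subseteq_mset_def intro: order_trans intro!: diff_le_mono)
    next
      case (3 b)
      then show ?case by auto
    next
      case (4 b)
      obtain l n where b: "b = (l, n)" by fastforce
      have "count l x + count n x \<le> count m x" for x
      proof -
        have "count l x \<le> count m x" "count n x \<le> count m x - count l x"
          using 4 b by (auto simp: subseteq_mset_def)
        then show ?thesis by linarith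
      qed
      then show ?case using 4 b by (auto simp: subseteq_mset_def)
    next
      case (5 a)
      obtain k l where a: "a = (k, l)" by fastforce
      have "l \<subseteq># k" using 5 a by auto
      then have "m - l - (k - l) = m - k"
        by (metis subset_mset.add_diff_inverse diff_diff_add_mset)
      then show ?case using a by (simp add: mult.assoc)
    qed
    also have "\<dots> = (\<Sum>k | k \<subseteq># m. f k * (\<Sum>l | l \<subseteq># m - k. g l * h (m - k - l)))"
      by (simp add: sum_distrib_left sum.Sigma finite_submultisets)
    finally show "(\<Sum>k | k \<subseteq># m. (\<Sum>l | l \<subseteq># k. f l * g (k - l)) * h (m - k))
        = (\<Sum>k | k \<subseteq># m. f k * (\<Sum>l | l \<subseteq># m - k. g l * h (m - k - l)))" .
  qed
qed

end

definition mps_term :: "'c \<Rightarrow> 'v \<Rightarrow> ('v, 'c::comm_ring_1) mps" where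
  "mps_term c v = Abs_mps (\<lambda>m. if m = {#v#} then c else 0)"

lemma mps_coeff_simps [simp]:
  fixes f g :: "('v, 'c::comm_ring_1) mps"
  shows "mps_coeff (Abs_mps F) = F" "mps_coeff 0 m = (0::'c)"
    "mps_coeff (1 :: ('v, 'c) mps) m = (if m = {#} then 1 else 0)"
    "mps_coeff (f + g) m = mps_coeff f m + mps_coeff g m"
    "mps_coeff (f - g) m = mps_coeff f m - mps_coeff g m"
    "mps_coeff (- f) m = - mps_coeff f m"
  by (simp_all add: Abs_mps_inverse zero_mps.rep_eq one_mps.rep_eq plus_mps.rep_eq
      minus_mps.rep_eq uminus_mps.rep_eq)

lemma mps_coeff_sum:
  "mps_coeff (sum f I) m = (\<Sum>i\<in>I. mps_coeff (f i) m :: 'c::comm_ring_1)"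
  by (induction I rule: infinite_finite_induct) auto

lemma mps_coeff_mult:
  "mps_coeff (f * g) m = (\<Sum>k | k \<subseteq># m. mps_coeff f k * mps_coeff g (m - k) :: 'c::comm_ring_1)"
  by (simp add: times_mps.rep_eq)

lemma mps_coeff_mult_nonzeroE:
  assumes "mps_coeff (f * g) m \<noteq> (0 :: 'c::comm_ring_1)"
  obtains k where "k \<subseteq># m" "mps_coeff f k \<noteq> 0" "mps_coeff g (m - k) \<noteq> 0"
proof -
  obtain k where "k \<subseteq># m" "mps_coeff f k * mps_coeff g (m - k) \<noteq> 0"
    using assms unfolding mps_coeff_mult by (auto elim: sum.not_neutral_contains_not_neutral)
  then show ?thesis using that[of k] by (metis mult_zero_left mult_zero_right)
qed

lemma mps_coeff_term_mult:
  "mps_coeff (mps_term c v * g) m =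
     (if v \<in># m then c * mps_coeff g (m - {#v#}) else (0::'c::comm_ring_1))"
proof -
  have "mps_coeff (mps_term c v * g) m
      = (\<Sum>k | k \<subseteq># m. if k = {#v#} then c * mps_coeff g (m - {#v#}) else 0)"
    unfolding mps_coeff_mult by (rule sum.cong) (auto simp: mps_term_def)
  also have "\<dots> = (if v \<in># m then c * mps_coeff g (m - {#v#}) else 0)"
    by (subst sum.delta) (auto simp: finite_submultisets)
  finally show ?thesis .
qed

text \<open>
  Possibly infinite sums and products are coefficientwise limits: each coefficient is the eventual
  value of that coefficient in the finite partial sums (products).
\<close>

definition mps_suminf :: "('i \<Rightarrow> ('v, 'c::comm_ring_1) mps) \<Rightarrow> 'i set \<Rightarrow> ('v, 'c) mps" where
  "mps_suminf f I = Abs_mps (\<lambda>m.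
     THE c. \<forall>\<^sub>F F in finite_subsets_at_top I. mps_coeff (\<Sum>i\<in>F. f i) m = c)"

definition mps_prodinf :: "('i \<Rightarrow> ('v, 'c::comm_ring_1) mps) \<Rightarrow> 'i set \<Rightarrow> ('v, 'c) mps" where
  "mps_prodinf f I = Abs_mps (\<lambda>m.
     THE c. \<forall>\<^sub>F F in finite_subsets_at_top I. mps_coeff (\<Prod>i\<in>F. f i) m = c)"

lemma the_eventual_value:
  assumes "\<forall>\<^sub>F F in finite_subsets_at_top I. g F = c"
  shows "(THE c. \<forall>\<^sub>F F in finite_subsets_at_top I. g F = c) = c"
proof (rule the_equality)
  fix c' assume "\<forall>\<^sub>F F in finite_subsets_at_top I. g F = c'"
  with assms have "\<forall>\<^sub>F F in finite_subsets_at_top I. c' = c"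
    by eventually_elim auto
  then show "c' = c" by simp
qed (use assms in auto)

lemma mps_coeff_suminf:
  fixes f :: "'i \<Rightarrow> ('v, 'c::comm_ring_1) mps"
  assumes fin: "finite {i \<in> I. mps_coeff (f i) m \<noteq> 0}"
  shows "mps_coeff (mps_suminf f I) m = (\<Sum>i | i \<in> I \<and> mps_coeff (f i) m \<noteq> 0. mps_coeff (f i) m)"
proof -
  have "\<forall>\<^sub>F F in finite_subsets_at_top I. mps_coeff (\<Sum>i\<in>F. f i) m =
      (\<Sum>i | i \<in> I \<and> mps_coeff (f i) m \<noteq> 0. mps_coeff (f i) m)"
    unfolding eventually_finite_subsets_at_top
    by (rule exI[of _ "{i \<in> I. mps_coeff (f i) m \<noteq> 0}"])
       (auto simp: mps_coeff_sum fin intro!: sum.mono_neutral_right)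
  then show ?thesis unfolding mps_suminf_def by (simp add: the_eventual_value)
qed

lemma mps_coeff_prodinf:
  fixes c :: "'i \<Rightarrow> 'c::comm_ring_1"
  assumes inj: "inj_on v I"
  shows "mps_coeff (mps_prodinf (\<lambda>i. 1 + mps_term (c i) (v i)) I) m =
    mps_coeff (\<Prod>i | i \<in> I \<and> v i \<in># m. 1 + mps_term (c i) (v i)) m"
proof -
  define J where "J = {i \<in> I. v i \<in># m}"
  have "finite J"
    by (rule inj_on_finite[of v J "set_mset m"]) (use inj in \<open>auto simp: J_def inj_on_def\<close>)
  have *: "mps_coeff (\<Prod>i\<in>J \<union> K. 1 + mps_term (c i) (v i)) m
      = mps_coeff (\<Prod>i\<in>J. 1 + mps_term (c i) (v i)) m"
    if "finite K" "K \<subseteq> I - J" for K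
    using that
  proof (induction K rule: finite_induct)
    case (insert k K)
    then show ?case using \<open>finite J\<close>
      by (simp add: distrib_right mps_coeff_term_mult) (auto simp: J_def)
  qed simp
  have "\<forall>\<^sub>F F in finite_subsets_at_top I. mps_coeff (\<Prod>i\<in>F. 1 + mps_term (c i) (v i)) m =
      mps_coeff (\<Prod>i\<in>J. 1 + mps_term (c i) (v i)) m"
    unfolding eventually_finite_subsets_at_top
  proof (intro exI[of _ J] conjI allI impI)
    fix F assume F: "finite F \<and> J \<subseteq> F \<and> F \<subseteq> I"
    then show "mps_coeff (\<Prod>i\<in>F. 1 + mps_term (c i) (v i)) m =
        mps_coeff (\<Prod>i\<in>J. 1 + mps_term (c i) (v i)) m"
      using *[of "F - J"] by (simp add: Un_absorb1 Diff_mono Un_Diff_cancel)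
  qed (use \<open>finite J\<close> in \<open>auto simp: J_def\<close>)
  then show ?thesis unfolding mps_prodinf_def J_def by (simp add: the_eventual_value)
qed

lemma mps_invertible:
  fixes f :: "('v, 'c::comm_ring_1) mps"
  assumes "mps_coeff f {#} = 1"
  shows "\<exists>g. g * f = 1"
proof -
  define u where "u = 1 - f"
  have u0: "mps_coeff u {#} = 0" using assms by (simp add: u_def)
  have pow: "mps_coeff (u ^ n) m = 0" if "size m < n" for n m
    using that
  proof (induction n arbitrary: m)
    case (Suc n)
    have "mps_coeff u k * mps_coeff (u ^ n) (m - k) = 0" if k: "k \<subseteq># m" for k
    proof (cases "k = {#}")
      case False
      then have "size (m - k) < n"
        using k Suc.prems size_mset_mono[OF k] nonempty_has_size[of k]
        by (simp add: size_Diff_submset)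
      then show ?thesis using Suc.IH by simp
    qed (simp add: u0)
    then show ?case by (simp add: mps_coeff_mult)
  qed simp
  define g where "g = Abs_mps (\<lambda>m. mps_coeff (\<Sum>n\<le>size m. u ^ n) m)"
  have g: "mps_coeff g m = mps_coeff (\<Sum>n\<le>N. u ^ n) m" if "size m \<le> N" for m N
    unfolding g_def mps_coeff_simps mps_coeff_sum
    using that by (intro sum.mono_neutral_left) (auto simp: pow)
  have "g * f = 1"
  proof (rule mps_eqI)
    fix m
    have "mps_coeff (g * f) m = mps_coeff ((\<Sum>n\<le>size m. u ^ n) * f) m"
      unfolding mps_coeff_mult
      by (intro sum.cong refl) (subst g[of _ "size m"], auto intro: size_mset_mono)
    also have "(\<Sum>n\<le>size m. u ^ n) * f = 1 - u ^ Suc (size m)"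
    proof -
      have "f = 1 - u" by (simp add: u_def)
      then show ?thesis
        using one_diff_power_eq[of u "Suc (size m)"]
        by (simp only: lessThan_Suc_atMost mult.commute)
    qed
    also have "mps_coeff (1 - u ^ Suc (size m)) m = mps_coeff 1 m"
      using pow[of m "Suc (size m)"] by (simp del: power_Suc)
    finally show "mps_coeff (g * f) m = mps_coeff 1 m" .
  qed
  then show ?thesis ..
qed


section \<open>Super Schur functions\<close>

text \<open>Partitions are functions on row indices \<open>0, 1, \<dots>\<close>; containment of diagrams is \<open>\<le>\<close>.\<close>

definition is_partition :: "(nat \<Rightarrow> nat) \<Rightarrow> bool" where
  "is_partition p \<longleftrightarrow> antimono p \<and> finite {i. p i \<noteq> 0}"

definition conj_part :: "(nat \<Rightarrow> nat) \<Rightarrow> (nat \<Rightarrow> nat)" where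
  "conj_part p = (\<lambda>j. card {i. j < p i})"

definition skew_diagram :: "(nat \<Rightarrow> nat) \<Rightarrow> (nat \<Rightarrow> nat) \<Rightarrow> (nat \<times> nat) set" where
  "skew_diagram lam mu = {(i, j). mu i \<le> j \<and> j < lam i}"

text \<open>
  The alphabet \<open>V\<close> is ordered by the enumeration \<open>to_nat_on V\<close>; as skew Schur functions are
  symmetric, the choice of the linear order is immaterial.
\<close>

definition ssyts :: "'v set \<Rightarrow> (nat \<Rightarrow> nat) \<Rightarrow> (nat \<Rightarrow> nat) \<Rightarrow> (nat \<times> nat \<Rightarrow> 'v) set" where
  "ssyts V lam mu = {T \<in> skew_diagram lam mu \<rightarrow>\<^sub>E V.
     (\<forall>i j j'. (i, j) \<in> skew_diagram lam mu \<and> (i, j') \<in> skew_diagram lam mu \<and> j < j' \<longrightarrow>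
        to_nat_on V (T (i, j)) \<le> to_nat_on V (T (i, j'))) \<and>
     (\<forall>i i' j. (i, j) \<in> skew_diagram lam mu \<and> (i', j) \<in> skew_diagram lam mu \<and> i < i' \<longrightarrow>
        to_nat_on V (T (i, j)) < to_nat_on V (T (i', j)))}"

definition skew_schur ::
  "'v set \<Rightarrow> (nat \<Rightarrow> nat) \<Rightarrow> (nat \<Rightarrow> nat) \<Rightarrow> ('v, 'c::comm_ring_1) mps" where
  "skew_schur V lam mu = Abs_mps (\<lambda>m. of_nat (card
     {T \<in> ssyts V lam mu. image_mset T (mset_set (skew_diagram lam mu)) = m}))"

definition super_schur ::
  "'v set \<Rightarrow> 'v set \<Rightarrow> (nat \<Rightarrow> nat) \<Rightarrow> (nat \<Rightarrow> nat) \<Rightarrow> ('v, 'c::comm_ring_1) mps" where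
  "super_schur V0 V1 lam mu = (\<Sum>nu | is_partition nu \<and> mu \<le> nu \<and> nu \<le> lam.
     skew_schur V0 nu mu * skew_schur V1 (conj_part lam) (conj_part nu))"

lemma finite_skew_diagram: "is_partition lam \<Longrightarrow> finite (skew_diagram lam mu)"
  by (rule finite_subset[of _ "Sigma {i. lam i \<noteq> 0} (\<lambda>i. {..<lam i})"])
     (auto simp: skew_diagram_def is_partition_def)

lemma finite_above:
  assumes "is_partition lam"
  shows "finite {i. (j::nat) < lam i}"
  by (rule finite_subset[of _ "{i. lam i \<noteq> 0}"]) (use assms in \<open>auto simp: is_partition_def\<close>)

lemma finite_skew_diagram_conjugate:
  assumes "is_partition lam"
  shows "finite (skew_diagram (conj_part lam) mu)"
proof (rule finite_subset)
  have "j < lam 0 \<and> i < conj_part lam 0" if "i < conj_part lam j" for i j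
  proof -
    have "{i. j < lam i} \<noteq> {}" using that by (metis card.empty conj_part_def not_less_zero)
    then obtain k where "j < lam k" by auto
    moreover have "lam k \<le> lam 0" using assms by (simp add: is_partition_def antimonoD)
    moreover have "conj_part lam j \<le> conj_part lam 0"
      unfolding conj_part_def by (rule card_mono) (auto simp: finite_above[OF assms])
    ultimately show ?thesis using that by linarith
  qed
  then show "skew_diagram (conj_part lam) mu \<subseteq> {..<lam 0} \<times> {..<conj_part lam 0}"
    by (auto simp: skew_diagram_def)
qed simp

lemma skew_schur_nonzeroD:
  assumes "mps_coeff (skew_schur V lam mu) m \<noteq> (0::'c::comm_ring_1)"
  shows "size m = card (skew_diagram lam mu)"
proof -
  have "{T \<in> ssyts V lam mu. image_mset T (mset_set (skew_diagram lam mu)) = m} \<noteq> {}"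
  proof
    assume "{T \<in> ssyts V lam mu. image_mset T (mset_set (skew_diagram lam mu)) = m} = {}"
    then have "mps_coeff (skew_schur V lam mu) m = (0::'c)"
      unfolding skew_schur_def mps_coeff_simps by (simp only: card.empty of_nat_0)
    with assms show False ..
  qed
  then show ?thesis by (metis (mono_tags, lifting) Collect_empty_eq size_image_mset size_mset_set)
qed

lemma super_schur_nonzeroD:
  assumes lam: "is_partition lam"
    and nz: "mps_coeff (super_schur V0 V1 lam mu) m \<noteq> (0::'c::comm_ring_1)"
  shows "lam i - mu i \<le> size m"
proof -
  obtain nu where nu: "is_partition nu" and
    nu_nz: "mps_coeff (skew_schur V0 nu mu * skew_schur V1 (conj_part lam) (conj_part nu)) m \<noteq> (0::'c)"
    using nz unfolding super_schur_def mps_coeff_sum by (auto elim: sum.not_neutral_contains_not_neutral)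
  from nu_nz obtain k where k: "k \<subseteq># m" "mps_coeff (skew_schur V0 nu mu) k \<noteq> (0::'c)"
    "mps_coeff (skew_schur V1 (conj_part lam) (conj_part nu)) (m - k) \<noteq> (0::'c)"
    by (rule mps_coeff_mult_nonzeroE)
  have "nu i - mu i = card (Pair i ` {mu i..<nu i})" by (simp add: card_image inj_on_def)
  also have "\<dots> \<le> size k" unfolding skew_schur_nonzeroD[OF k(2)]
    by (rule card_mono[OF finite_skew_diagram[OF nu]]) (auto simp: skew_diagram_def)
  finally have 1: "nu i - mu i \<le> size k" .
  have "conj_part nu j \<le> i \<and> i < conj_part lam j" if "nu i \<le> j" "j < lam i" for j
  proof
    have "{i'. j < nu i'} \<subseteq> {..<i}"
    proof
      fix i' assume "i' \<in> {i'. j < nu i'}"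
      then have "\<not> nu i' \<le> nu i" using that by auto
      then show "i' \<in> {..<i}"
        using nu antimonoD[of nu i i'] by (cases "i \<le> i'") (auto simp: is_partition_def)
    qed
    then show "conj_part nu j \<le> i"
      unfolding conj_part_def using card_mono[of "{..<i}"] by fastforce
    have "{..i} \<subseteq> {i'. j < lam i'}"
      using that lam by (auto simp: is_partition_def dest: antimonoD intro: less_le_trans)
    from card_mono[OF finite_above[OF lam] this] show "i < conj_part lam j"
      unfolding conj_part_def by simp
  qed
  then have "(\<lambda>j. (j, i)) ` {nu i..<lam i} \<subseteq> skew_diagram (conj_part lam) (conj_part nu)"
    by (auto simp: skew_diagram_def)
  from card_mono[OF finite_skew_diagram_conjugate[OF lam] this]
  have 2: "lam i - nu i \<le> size (m - k)"
    unfolding skew_schur_nonzeroD[OF k(3)] by (simp add: card_image inj_on_def)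
  have "size m = size k + size (m - k)"
    using k(1) by (metis size_union subset_mset.add_diff_inverse)
  then show ?thesis using 1 2 by linarith
qed


section \<open>The series attached to a pair of graded sets\<close>

text \<open>
  The variables are indexed by \<open>'a + 'b\<close>: \<open>Inl a\<close> stands for \<open>x\<^sub>a\<close> and \<open>Inr b\<close> for the
  inverse variable of \<open>b\<close>.
\<close>

definition dominant :: "nat \<Rightarrow> int list set" where
  "dominant d = {xs. length xs = d \<and> sorted_wrt (\<ge>) xs}"

text \<open>\<open>shift_part p xs\<close> is \<open>xs + (p\<^sup>d)\<close>; it is only used when all entries become nonnegative.\<close>

definition shift_part :: "nat \<Rightarrow> int list \<Rightarrow> (nat \<Rightarrow> nat)" where
  "shift_part p xs = (\<lambda>i. if i < length xs then nat (xs ! i + int p) else 0)"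

definition rect :: "nat \<Rightarrow> nat \<Rightarrow> (nat \<Rightarrow> nat)" where
  "rect p d = (\<lambda>i. if i < d then p else 0)"

text \<open>
  A pair of skew diagrams is encoded by \<open>kappa = eta - (p\<^sup>d)\<close>. The representative chosen is the one
  with the least possible \<open>p\<close>, namely \<open>p = - last kappa\<close> (so that \<open>eta\<close> has last part \<open>0\<close>);
  \<open>lam + (p\<^sup>d)\<close> is then a partition since \<open>last kappa \<le> last lam\<close>.
\<close>

definition SAB_index :: "int list \<Rightarrow> int list set" where
  "SAB_index lam = {kappa \<in> dominant (length lam). \<forall>i<length lam. kappa ! i \<le> min (lam ! i) 0}"

definition SAB_term ::
  "'a set \<Rightarrow> 'a set \<Rightarrow> 'b set \<Rightarrow> 'b set \<Rightarrow> int list \<Rightarrow> int list \<Rightarrow> ('a + 'b, 'c::comm_ring_1) mps" where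
  "SAB_term A0 A1 B0 B1 lam kappa =
     (let p = nat (- last kappa); eta = shift_part p kappa
      in super_schur (Inl ` A0) (Inl ` A1) (shift_part p lam) eta *
         super_schur (Inr ` B0) (Inr ` B1) (rect p (length lam)) eta)"

definition SAB ::
  "'a set \<Rightarrow> 'a set \<Rightarrow> 'b set \<Rightarrow> 'b set \<Rightarrow> int list \<Rightarrow> ('a + 'b, 'c::comm_ring_1) mps" where
  "SAB A0 A1 B0 B1 lam = mps_suminf (SAB_term A0 A1 B0 B1 lam) (SAB_index lam)"

text \<open>The sum converges: each monomial occurs in finitely many terms.\<close>

lemma is_partition_rect: "is_partition (rect p d)"
  by (auto simp: is_partition_def rect_def antimono_def)

lemma finite_SAB_terms:
  "finite {kappa \<in> SAB_index lam. mps_coeff (SAB_term A0 A1 B0 B1 lam kappa) m \<noteq> (0::'c::comm_ring_1)}"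
proof (rule finite_subset)
  let ?L = "{xs. set xs \<subseteq> {- int (size m)..0} \<and> length xs = length lam}"
  show "finite ?L" by (intro finite_lists_length_eq) simp
  show "{kappa \<in> SAB_index lam. mps_coeff (SAB_term A0 A1 B0 B1 lam kappa) m \<noteq> (0::'c)} \<subseteq> ?L"
  proof clarify
    fix kappa
    assume kappa: "kappa \<in> SAB_index lam"
      and nz: "mps_coeff (SAB_term A0 A1 B0 B1 lam kappa) m \<noteq> (0::'c)"
    define p where "p = nat (- last kappa)"
    have len: "length kappa = length lam" using kappa by (simp add: SAB_index_def dominant_def)
    obtain k where k: "k \<subseteq># m" "mps_coeff (super_schur (Inr ` B0) (Inr ` B1) (rect p (length lam))
        (shift_part p kappa)) (m - k) \<noteq> (0::'c)"
      using nz unfolding SAB_term_def Let_def p_def[symmetric]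
      by (rule mps_coeff_mult_nonzeroE)
    have "kappa ! i \<in> {- int (size m)..0}" if i: "i < length kappa" for i
    proof -
      have le0: "kappa ! i \<le> 0" using kappa i len by (auto simp: SAB_index_def)
      have "p - nat (kappa ! i + int p) \<le> size (m - k)"
        using super_schur_nonzeroD[OF is_partition_rect k(2), of i] i len
        by (simp add: rect_def shift_part_def)
      also have "\<dots> \<le> size m" by (simp add: size_mset_mono)
      finally have *: "p - nat (kappa ! i + int p) \<le> size m" .
      have "kappa \<noteq> []" using i by auto
      have "last kappa \<le> kappa ! i"
      proof (cases "i = length kappa - 1")
        case True
        then show ?thesis by (simp add: last_conv_nth[OF \<open>kappa \<noteq> []\<close>])
      next
        case False
        then show ?thesis using i kappa
          by (auto simp: SAB_index_def dominant_def sorted_wrt_iff_nth_less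
              last_conv_nth[OF \<open>kappa \<noteq> []\<close>])
      qed
      then show ?thesis using * le0 by (auto simp: p_def)
    qed
    then show "set kappa \<subseteq> {- int (size m)..0} \<and> length kappa = length lam"
      using len by (auto simp: in_set_conv_nth)
  qed
qed

text \<open>
  The generating function lives in power series over Laurent series in \<open>t\<close>. The coefficient of each
  monomial in the variables is a Laurent polynomial in \<open>t\<close>, so that sorting by powers of \<open>t\<close> gives
  a series \<open>\<Sum>k. h k * t ^ k\<close> with \<open>k\<close> ranging over all integers.
\<close>

definition hAB_numer ::
  "'a set \<Rightarrow> 'b set \<Rightarrow> ('a + 'b, 'c::comm_ring_1 fls) mps" where
  "hAB_numer A1 B1 =
     mps_prodinf (\<lambda>a. 1 + mps_term fls_X (Inl a)) A1 *
     mps_prodinf (\<lambda>b. 1 + mps_term fls_X_inv (Inr b)) B1"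

definition hAB_denom ::
  "'a set \<Rightarrow> 'b set \<Rightarrow> ('a + 'b, 'c::comm_ring_1 fls) mps" where
  "hAB_denom A0 B0 =
     mps_prodinf (\<lambda>a. 1 - mps_term fls_X (Inl a)) A0 *
     mps_prodinf (\<lambda>b. 1 - mps_term fls_X_inv (Inr b)) B0"

definition hAB_gf ::
  "'a set \<Rightarrow> 'a set \<Rightarrow> 'b set \<Rightarrow> 'b set \<Rightarrow> ('a + 'b, 'c::comm_ring_1 fls) mps" where
  "hAB_gf A0 A1 B0 B1 = (THE G. G * hAB_denom A0 B0 = hAB_numer A1 B1)"

lemma mps_prodinf_minus_const:
  fixes t :: "'c::comm_ring_1"
  assumes "inj_on v I"
  shows "mps_coeff (mps_prodinf (\<lambda>i. 1 - mps_term t (v i)) I) {#} = 1"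
proof -
  have "mps_term (- t) w = - mps_term t w" for w :: 'b
    by (rule mps_eqI) (simp add: mps_term_def)
  then show ?thesis using mps_coeff_prodinf[OF assms, of "\<lambda>_. - t" "{#}"] by simp
qed

lemma hAB_denom_const: "mps_coeff (hAB_denom A0 B0 :: ('a + 'b, 'c::comm_ring_1 fls) mps) {#} = 1"
  by (simp add: hAB_denom_def mps_coeff_mult mps_prodinf_minus_const)

lemma hAB_gf_eq:
  "hAB_gf A0 A1 B0 B1 * hAB_denom A0 B0 = (hAB_numer A1 B1 :: ('a + 'b, 'c::comm_ring_1 fls) mps)"
proof -
  obtain g :: "('a + 'b, 'c fls) mps" where g: "g * hAB_denom A0 B0 = 1"
    using mps_invertible[OF hAB_denom_const] by blast
  show ?thesis unfolding hAB_gf_def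
  proof (rule theI[of _ "hAB_numer A1 B1 * g"])
    show "hAB_numer A1 B1 * g * hAB_denom A0 B0 = hAB_numer A1 B1"
      by (simp add: mult.assoc g)
    fix G :: "('a + 'b, 'c fls) mps"
    assume G: "G * hAB_denom A0 B0 = hAB_numer A1 B1"
    have "G = G * (g * hAB_denom A0 B0)" by (simp add: g)
    also have "\<dots> = G * hAB_denom A0 B0 * g" by (simp add: ac_simps)
    finally show "G = hAB_numer A1 B1 * g" by (simp add: G)
  qed
qed

definition hAB ::
  "'a set \<Rightarrow> 'a set \<Rightarrow> 'b set \<Rightarrow> 'b set \<Rightarrow> int \<Rightarrow> ('a + 'b, 'c::comm_ring_1) mps" where
  "hAB A0 A1 B0 B1 k = Abs_mps (\<lambda>m. fls_nth (mps_coeff (hAB_gf A0 A1 B0 B1) m) k)"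

end

theory Submission
  imports Defs
begin

text \<open>
  The idea is to read every function in the statement as a minor of a Toeplitz matrix. For a sequence
  \<open>h\<close> indexed by the integers, \<open>toeplitz_minor d h a b\<close> is the determinant of the matrix \<open>h (a i - b j)\<close>, and a
  shape \<open>lam\<close> with at most \<open>d\<close> rows is encoded by the strictly decreasing sequence \<open>lam i - i\<close>. If the
  generating functions of two sequences are multiplied, the Toeplitz matrices are multiplied, and the
  Cauchy--Binet formula (\<open>cauchy_binet\<close>) writes a minor of the product as a sum over intermediate
  decreasing sequences, that is, over intermediate shapes.

  For a single variable the minors can be evaluated: \<open>1 / (1 - x t)\<close> gives a power of \<open>x\<close> if the two
  shapes differ by a horizontal strip and \<open>0\<close> otherwise (\<open>minor_geometric\<close>), and \<open>1 + x t\<close> does the same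
  with vertical strips (\<open>minor_01\<close>). On the other side, removing the largest letter from a semistandard
  tableau removes a horizontal strip, or a vertical one after transposition (\<open>sum_tableaux_peel\<close>).
  Adding one variable at a time therefore identifies skew Schur functions with minors, and composing
  the even and the odd letters gives the Jacobi--Trudi identity for super Schur functions
  (\<open>super_jacobi_trudi\<close>).

  The sequence \<open>hAB\<close> is the convolution of the complete functions of the first alphabet with the
  reversed ones of the second (\<open>agree_hAB_convolution\<close>). So the determinant in question is a minor of a
  product of two Toeplitz matrices, one of them transposed, and a last application of Cauchy--Binet
  expands it as a sum over decreasing sequences \<open>kappa ! l - l\<close> of a minor for \<open>lam\<close> times a minor for the
  empty shape. Both vanish unless \<open>kappa\<close> lies below \<open>lam\<close> and below \<open>0\<close>. After a shift of all
  rows that makes the shapes partitions, the two minors are the two super Schur functions in the term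
  of \<open>SAB\<close> at \<open>kappa\<close>.

  Infinite alphabets and the infinite sum over \<open>kappa\<close> cause no analysis: the coefficient at a
  monomial \<open>m\<close> depends only on coefficients at divisors of \<open>m\<close>, and modulo all other monomials (the
  relation \<open>agree\<close>) only finitely many letters and indices matter.
\<close>

section \<open>Toeplitz minors and the Cauchy--Binet formula\<close>

lemma permutes_inversion:
  assumes p: "p permutes {0..<d::nat}" and "p \<noteq> id"
  obtains i i' where "i < i'" "i' < d" "p i' < p i"
proof -
  have "\<exists>i i'. i < i' \<and> i' < d \<and> p i' < p i"
  proof (rule ccontr)
    assume no: "\<not> ?thesis"
    have mono: "p i < p i'" if "i < i'" "i' < d" for i i'
    proof -
      have "p i \<noteq> p i'" using that permutes_inj[OF p] by (auto dest: injD)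
      moreover have "\<not> p i' < p i" using no that by blast
      ultimately show ?thesis by linarith
    qed
    have ge: "i \<le> p i" if "i < d" for i
      using that
    proof (induction i)
      case (Suc i)
      then show ?case using mono[of i "Suc i"] by simp
    qed simp
    have "p i = i" if "i < d" for i
      using that
    proof (induction "d - i" arbitrary: i rule: less_induct)
      case less
      show ?case
      proof (rule ccontr)
        assume "p i \<noteq> i"
        then have "i < p i" "p i < d"
          using ge[OF less.prems] permutes_in_image[OF p, of i] less.prems by auto
        then have "p (p i) = p i" using less.hyps[of "p i"] by simp
        then show False using permutes_inj[OF p] \<open>p i \<noteq> i\<close> by (auto dest: injD)
      qed
    qed
    then have "p = id" using p by (auto simp: permutes_def fun_eq_iff)
    then show False using \<open>p \<noteq> id\<close> by simp
  qed
  then show ?thesis using that by blast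
qed

text \<open>
  The hypothesis kills every term of the Leibniz expansion in which the permutation has an inversion,
  and only the identity has none. The minors attached to a single variable are evaluated this way.
\<close>

lemma det_no_inversions:
  fixes A :: "nat \<Rightarrow> nat \<Rightarrow> 'r::comm_ring_1"
  assumes inv: "\<And>i i' j j'. i < i' \<Longrightarrow> i' < d \<Longrightarrow> j' < j \<Longrightarrow> j < d \<Longrightarrow> A i j = 0 \<or> A i' j' = 0"
  shows "det (mat d d (\<lambda>(i, j). A i j)) = (\<Prod>i<d. A i i)"
proof -
  have zero: "(\<Prod>i = 0..<d. A i (p i)) = 0" if p: "p permutes {0..<d}" and "p \<noteq> id" for p
  proof -
    obtain i i' where i: "i < i'" "i' < d" "p i' < p i"
      using permutes_inversion[OF p \<open>p \<noteq> id\<close>] by blast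
    moreover have "p i < d" using permutes_in_image[OF p, of i] i by simp
    ultimately have "A i (p i) = 0 \<or> A i' (p i') = 0" by (intro inv)
    then show ?thesis using i by (auto intro!: prod_zero)
  qed
  have "det (mat d d (\<lambda>(i, j). A i j))
      = (\<Sum>p | p permutes {0..<d}. signof p * (\<Prod>i = 0..<d. A i (p i)))"
    by (subst det_def'[of _ d]) (auto intro!: sum.cong prod.cong dest: permutes_in_image)
  also have "\<dots> = (\<Sum>p\<in>{id}. signof p * (\<Prod>i = 0..<d. A i (p i)))"
    by (rule sum.mono_neutral_right) (auto simp: zero finite_permutations permutes_id)
  finally show ?thesis by (simp add: atLeast0LessThan)
qed

text \<open>
  A choice of \<open>d\<close> rows or columns, listed decreasingly to match the convention that the entries
  \<open>lam i - i\<close> attached to a shape strictly decrease with \<open>i\<close>.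
\<close>

definition dec_lists :: "nat \<Rightarrow> int set \<Rightarrow> int list set" where
  "dec_lists d K = {g. length g = d \<and> sorted_wrt (>) g \<and> set g \<subseteq> K}"

lemma finite_dec_lists: "finite K \<Longrightarrow> finite (dec_lists d K)"
  by (rule finite_subset[OF _ finite_lists_length_eq[of K d]]) (auto simp: dec_lists_def)

lemma dec_lists_distinct:
  assumes "g \<in> dec_lists d K"
  shows "distinct g"
proof -
  have "sorted_wrt (\<lambda>x y. x \<noteq> y) g"
    using assms sorted_wrt_mono_rel[of g "(>)" "\<lambda>x y. x \<noteq> y"] by (auto simp: dec_lists_def)
  then show ?thesis by (simp add: distinct_conv_nth sorted_wrt_iff_nth_less nat_neq_iff)
      (metis linorder_neqE_nat)
qed

lemma dec_lists_eqI:
  assumes g: "g \<in> dec_lists d K" and h: "h \<in> dec_lists d' K'" and "set g = set h"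
  shows "g = h"
proof -
  have "sorted_wrt (<) (rev g)" "sorted_wrt (<) (rev h)"
    using g h by (simp_all add: dec_lists_def sorted_wrt_rev)
  then have "rev g = rev h" using assms(3) by (intro strict_sorted_equal) auto
  then show ?thesis by simp
qed

text \<open>
  An injective choice of indices is the decreasing enumeration of its image followed by
  a permutation. This is the bookkeeping behind Cauchy--Binet.
\<close>

lemma bij_dec_lists_permutations:
  assumes "finite K"
  shows "bij_betw (\<lambda>(g, p). restrict (\<lambda>i. g ! p i) {0..<d})
    (dec_lists d K \<times> {p. p permutes {0..<d}})
    {f \<in> {0..<d} \<rightarrow>\<^sub>E K. inj_on f {0..<d}}"
proof (rule bij_betwI')
  fix x y
  assume "x \<in> dec_lists d K \<times> {p. p permutes {0..<d}}"
    and "y \<in> dec_lists d K \<times> {p. p permutes {0..<d}}"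
  then obtain g p h q where xy: "x = (g, p)" "y = (h, q)" and g: "g \<in> dec_lists d K"
    and h: "h \<in> dec_lists d K" and p: "p permutes {0..<d}" and q: "q permutes {0..<d}" by auto
  have im: "restrict (\<lambda>i. g ! p i) {0..<d} ` {0..<d} = set g"
    if "g \<in> dec_lists d K" "p permutes {0..<d}" for g p
  proof -
    have "(\<lambda>i. g ! p i) ` {0..<d} = (!) g ` (p ` {0..<d})" by (simp add: image_image)
    also have "\<dots> = set g"
      using that nth_image[of d g] by (simp add: permutes_image dec_lists_def)
    finally show ?thesis by simp
  qed
  show "((case x of (g, p) \<Rightarrow> restrict (\<lambda>i. g ! p i) {0..<d}) =
         (case y of (g, p) \<Rightarrow> restrict (\<lambda>i. g ! p i) {0..<d})) = (x = y)"
  proof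
    assume "(case x of (g, p) \<Rightarrow> restrict (\<lambda>i. g ! p i) {0..<d}) =
         (case y of (g, p) \<Rightarrow> restrict (\<lambda>i. g ! p i) {0..<d})"
    then have eq: "restrict (\<lambda>i. g ! p i) {0..<d} = restrict (\<lambda>i. h ! q i) {0..<d}"
      by (simp add: xy)
    then have "set g = set h" using im[OF g p] im[OF h q] by simp
    then have "g = h" using dec_lists_eqI g h by blast
    have "p i = q i" for i
    proof (cases "i < d")
      case True
      then have "g ! p i = g ! q i" using fun_cong[OF eq, of i] \<open>g = h\<close> by simp
      moreover have "p i < length g" "q i < length g"
        using True p q g permutes_in_image[of _ "{0..<d}" i] by (auto simp: dec_lists_def)
      ultimately show ?thesis using dec_lists_distinct[OF g] by (simp add: nth_eq_iff_index_eq)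
    next
      case False
      then show ?thesis using p q by (simp add: permutes_def)
    qed
    then show "x = y" using \<open>g = h\<close> xy by auto
  qed simp
next
  fix x
  assume "x \<in> dec_lists d K \<times> {p. p permutes {0..<d}}"
  then obtain g p where x: "x = (g, p)" and g: "g \<in> dec_lists d K" and p: "p permutes {0..<d}"
    by auto
  have lt: "p i < length g" if "i < d" for i
    using that g p permutes_in_image[OF p, of i] by (auto simp: dec_lists_def)
  have "inj_on (\<lambda>i. g ! p i) {0..<d}"
    using lt dec_lists_distinct[OF g] permutes_inj[OF p]
    by (auto simp: inj_on_def nth_eq_iff_index_eq dest: injD)
  then show "(case x of (g, p) \<Rightarrow> restrict (\<lambda>i. g ! p i) {0..<d})
      \<in> {f \<in> {0..<d} \<rightarrow>\<^sub>E K. inj_on f {0..<d}}"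
    using lt g by (auto simp: x inj_on_restrict_eq dec_lists_def)
next
  fix f assume "f \<in> {f \<in> {0..<d} \<rightarrow>\<^sub>E K. inj_on f {0..<d}}"
  then have fK: "f \<in> {0..<d} \<rightarrow>\<^sub>E K" and inj: "inj_on f {0..<d}" by auto
  define g where "g = rev (sorted_list_of_set (f ` {0..<d}))"
  have set_g: "set g = f ` {0..<d}" by (simp add: g_def)
  have len: "length g = d" using inj by (simp add: g_def card_image)
  have g: "g \<in> dec_lists d K" using fK set_g len
    by (auto simp: dec_lists_def g_def sorted_wrt_rev)
  have g_bij: "bij_betw ((!) g) {0..<d} (f ` {0..<d})"
    using dec_lists_distinct[OF g] len set_g bij_betw_nth[of g "{0..<d}" "f ` {0..<d}"]
    by (simp add: atLeast0LessThan)
  define p where "p = (\<lambda>i. if i \<in> {0..<d} then inv_into {0..<d} ((!) g) (f i) else i)"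
  have "bij_betw (inv_into {0..<d} ((!) g) \<circ> f) {0..<d} {0..<d}"
    using bij_betw_trans[OF inj_on_imp_bij_betw[OF inj] bij_betw_inv_into[OF g_bij]] .
  then have "bij_betw p {0..<d} {0..<d}"
    by (rule bij_betw_cong[THEN iffD1, rotated]) (simp add: p_def)
  then have p: "p permutes {0..<d}" by (rule bij_imp_permutes) (auto simp: p_def)
  have "f = restrict (\<lambda>i. g ! p i) {0..<d}"
  proof
    fix i show "f i = restrict (\<lambda>i. g ! p i) {0..<d} i"
    proof (cases "i \<in> {0..<d}")
      case True
      then have "g ! p i = f i" using bij_betw_inv_into_right[OF g_bij, of "f i"] by (simp add: p_def)
      then show ?thesis using True by simp
    next
      case False
      then show ?thesis using PiE_arb[OF fK] by simp
    qed
  qed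
  then show "\<exists>x\<in>dec_lists d K \<times> {p. p permutes {0..<d}}.
      f = (case x of (g, p) \<Rightarrow> restrict (\<lambda>i. g ! p i) {0..<d})"
    using g p by auto
qed

text \<open>
  Expanding the determinant row by row gives a sum over all maps \<open>f\<close> from rows to intermediate
  indices. A map that is not injective selects two equal rows of \<open>b\<close> and contributes \<open>0\<close>; an injective
  one splits as a decreasing list followed by a permutation, and the sum over permutations rebuilds
  the determinant of \<open>a\<close>.
\<close>

theorem cauchy_binet:
  fixes a :: "nat \<Rightarrow> int \<Rightarrow> 'r::comm_ring_1" and b :: "int \<Rightarrow> nat \<Rightarrow> 'r"
  assumes K: "finite K"
  shows "det (mat d d (\<lambda>(i, j). \<Sum>k\<in>K. a i k * b k j)) =
    (\<Sum>g\<in>dec_lists d K. det (mat d d (\<lambda>(i, l). a i (g ! l))) * det (mat d d (\<lambda>(l, j). b (g ! l) j)))"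
proof -
  let ?P = "{p. p permutes {0..<d}}" and ?F = "{0..<d} \<rightarrow>\<^sub>E K"
  let ?B = "\<lambda>f. det (mat d d (\<lambda>(i, j). b (f i) j))"
  have finF: "finite ?F" using K by (simp add: finite_PiE)
  have "det (mat d d (\<lambda>(i, j). \<Sum>k\<in>K. a i k * b k j))
      = (\<Sum>p\<in>?P. signof p * (\<Prod>i = 0..<d. \<Sum>k\<in>K. a i k * b k (p i)))"
    by (subst det_def'[of _ d]) (auto intro!: sum.cong prod.cong dest: permutes_in_image)
  also have "\<dots> = (\<Sum>p\<in>?P. \<Sum>f\<in>?F. (\<Prod>i = 0..<d. a i (f i)) * (signof p * (\<Prod>i = 0..<d. b (f i) (p i))))"
    by (subst prod_sum_PiE) (use K in \<open>auto simp: sum_distrib_left prod.distrib ac_simps\<close>)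
  also have "\<dots> = (\<Sum>f\<in>?F. (\<Prod>i = 0..<d. a i (f i)) * (\<Sum>p\<in>?P. signof p * (\<Prod>i = 0..<d. b (f i) (p i))))"
    by (subst sum.swap) (simp add: sum_distrib_left)
  also have "\<dots> = (\<Sum>f\<in>?F. (\<Prod>i = 0..<d. a i (f i)) * ?B f)"
    by (rule sum.cong[OF refl], subst det_def'[of _ d])
       (auto intro!: sum.cong prod.cong arg_cong2[of _ _ _ _ "(*)"] dest: permutes_in_image)
  also have "\<dots> = (\<Sum>f | f \<in> ?F \<and> inj_on f {0..<d}. (\<Prod>i = 0..<d. a i (f i)) * ?B f)"
  proof (intro sum.mono_neutral_right[OF finF] ballI)
    fix f assume "f \<in> ?F - {f. f \<in> ?F \<and> inj_on f {0..<d}}"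
    then have "\<not> inj_on f {0..<d}" by simp
    then obtain i i' where i: "i \<noteq> i'" "i < d" "i' < d" "f i = f i'" by (auto simp: inj_on_def)
    then have "?B f = 0"
      by (intro det_identical_rows[of _ d i i']) auto
    then show "(\<Prod>i = 0..<d. a i (f i)) * ?B f = 0" by simp
  qed auto
  also have "\<dots> = (\<Sum>(g, p)\<in>dec_lists d K \<times> ?P.
      (\<Prod>i = 0..<d. a i (g ! p i)) * ?B (\<lambda>i. g ! p i))"
  proof -
    have "?B (restrict f {0..<d}) = ?B f" for f :: "nat \<Rightarrow> int"
      by (intro arg_cong[of _ _ det] cong_mat) auto
    then show ?thesis
      by (subst sum.reindex_bij_betw[OF bij_dec_lists_permutations[OF K], symmetric])
         (auto intro!: sum.cong)
  qed
  also have "\<dots> = (\<Sum>g\<in>dec_lists d K. \<Sum>p\<in>?P.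
      (\<Prod>i = 0..<d. a i (g ! p i)) * ?B (\<lambda>i. g ! p i))"
    by (simp add: sum.cartesian_product)
  also have "\<dots> = (\<Sum>g\<in>dec_lists d K. (\<Sum>p\<in>?P.
      signof p * (\<Prod>i = 0..<d. a i (g ! p i))) * ?B (\<lambda>i. g ! i))"
  proof (rule sum.cong[OF refl])
    fix g
    have "?B (\<lambda>i. g ! p i) = signof p * ?B (\<lambda>i. g ! i)" if "p permutes {0..<d}" for p
    proof -
      have "?B (\<lambda>i. g ! p i) = det (mat d d (\<lambda>(i, j). mat d d (\<lambda>(i, j). b (g ! i) j) $$ (p i, j)))"
        using permutes_in_image[OF that] by (intro arg_cong[of _ _ det] cong_mat) auto
      also have "\<dots> = signof p * ?B (\<lambda>i. g ! i)"
        by (rule det_permute_rows[OF _ that]) simp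
      finally show ?thesis .
    qed
    then show "(\<Sum>p\<in>?P. (\<Prod>i = 0..<d. a i (g ! p i)) * ?B (\<lambda>i. g ! p i)) =
      (\<Sum>p\<in>?P. signof p * (\<Prod>i = 0..<d. a i (g ! p i))) * ?B (\<lambda>i. g ! i)"
      by (simp add: sum_distrib_left sum_distrib_right ac_simps)
  qed
  also have "\<dots> = (\<Sum>g\<in>dec_lists d K. det (mat d d (\<lambda>(i, l). a i (g ! l))) * ?B (\<lambda>i. g ! i))"
    by (rule sum.cong[OF refl], subst (2) det_def'[of _ d])
       (auto intro!: sum.cong prod.cong arg_cong2[of _ _ _ _ "(*)"] dest: permutes_in_image)
  finally show ?thesis .
qed

text \<open>
  A minor of the doubly infinite Toeplitz matrix of the sequence \<open>h\<close>, with rows \<open>a\<close> and columns \<open>b\<close>.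
  The determinant of the \<open>hAB\<close> and all super Schur functions are minors of this kind; multiplication
  of generating functions is multiplication of the Toeplitz matrices.
\<close>

definition toeplitz_minor :: "nat \<Rightarrow> (int \<Rightarrow> 'r) \<Rightarrow> (nat \<Rightarrow> int) \<Rightarrow> (nat \<Rightarrow> int) \<Rightarrow> 'r::comm_ring_1" where
  "toeplitz_minor d h a b = det (mat d d (\<lambda>(i, j). h (a i - b j)))"

lemma minor_cong:
  assumes "\<And>i j. i < d \<Longrightarrow> j < d \<Longrightarrow> h (a i - b j) = h' (a' i - b' j)"
  shows "toeplitz_minor d h a b = toeplitz_minor d h' a' b'"
  unfolding toeplitz_minor_def using assms by (intro arg_cong[of _ _ det] cong_mat) auto

text \<open>
  If \<open>a i < b i\<close> then the rows from \<open>i\<close> on and the columns up to \<open>i\<close> meet in a block of zeros, and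
  every permutation meets that block, because it cannot map \<open>{i..<d}\<close> into \<open>{Suc i..<d}\<close>. In terms of
  shapes: the minor vanishes unless the diagram of \<open>a\<close> contains that of \<open>b\<close>.
\<close>

lemma minor_eq_0:
  fixes h :: "int \<Rightarrow> 'r::comm_ring_1"
  assumes h: "\<And>k. k < 0 \<Longrightarrow> h k = 0"
    and a: "antimono_on {..<d} a" and b: "antimono_on {..<d} b"
    and i: "i < d" "a i < b i"
  shows "toeplitz_minor d h a b = 0"
proof -
  have "(\<Prod>k = 0..<d. h (a k - b (p k))) = 0" if p: "p permutes {0..<d}" for p
  proof -
    have "\<exists>k. i \<le> k \<and> k < d \<and> p k \<le> i"
    proof (rule ccontr)
      assume "\<not> ?thesis"
      then have "p ` {i..<d} \<subseteq> {Suc i..<d}" using permutes_in_image[OF p] by (auto simp: not_le Suc_le_eq)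
      then have "card {i..<d} \<le> card {Suc i..<d}"
        using card_inj_on_le[of p "{i..<d}" "{Suc i..<d}"] permutes_inj_on[OF p] by auto
      then show False using i by simp
    qed
    then obtain k where k: "i \<le> k" "k < d" "p k \<le> i" by auto
    have "a k \<le> a i" "b i \<le> b (p k)"
      using k i by (auto intro: monotone_onD[OF a] monotone_onD[OF b])
    then have "h (a k - b (p k)) = 0" using i by (intro h) simp
    then show ?thesis using k by (auto intro!: prod_zero)
  qed
  then have "(\<Sum>p | p permutes {0..<d}. signof p * (\<Prod>k = 0..<d. h (a k - b (p k)))) = (0::'r)"
    by simp
  moreover have "toeplitz_minor d h a b
      = (\<Sum>p | p permutes {0..<d}. signof p * (\<Prod>k = 0..<d. h (a k - b (p k))))"
    unfolding toeplitz_minor_def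
    by (subst det_def'[of _ d]) (auto intro!: sum.cong prod.cong dest: permutes_in_image)
  ultimately show ?thesis by simp
qed

text \<open>
  The case of the series \<open>1 + x t\<close>, that is of one odd variable: at an inversion
  \<open>a i - b j\<close> exceeds \<open>a i' - b j'\<close> by at least \<open>2\<close>, so the two cannot both lie in \<open>{0, 1}\<close>.
\<close>

lemma minor_01:
  fixes h :: "int \<Rightarrow> 'r::comm_ring_1"
  assumes h: "\<And>k. k \<noteq> 0 \<Longrightarrow> k \<noteq> 1 \<Longrightarrow> h k = 0"
    and a: "\<And>i j. i < j \<Longrightarrow> j < d \<Longrightarrow> a j < a i" and b: "\<And>i j. i < j \<Longrightarrow> j < d \<Longrightarrow> b j < b i"
  shows "toeplitz_minor d h a b = (\<Prod>i<d. h (a i - b i))"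
  unfolding toeplitz_minor_def
proof (rule det_no_inversions)
  fix i i' j j' assume "i < i'" "i' < d" "j' < j" "j < d"
  then have "a i' < a i" "b j < b j'" using a b by auto
  then have "\<not> (a i - b j \<in> {0, 1} \<and> a i' - b j' \<in> {0, 1})" by auto
  then show "h (a i - b j) = 0 \<or> h (a i' - b j') = 0" using h by auto
qed

text \<open>
  The case of the series \<open>1 / (1 - x t)\<close>, that is of one even variable. Subtracting from each row the
  multiple of the next one that cancels the common tail leaves row \<open>i\<close> with nonzero entries only in
  the columns \<open>j\<close> with \<open>a (Suc i) < b j \<le> a i\<close>. These ranges are disjoint and ordered, so no inversion
  survives. The remaining condition says that the shapes interlace.
\<close>

lemma minor_geometric:
  fixes x :: "'r::comm_ring_1"
  assumes h: "\<And>k. h k = (if k < 0 then 0 else x ^ nat k)"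
    and a: "\<And>i j. i < j \<Longrightarrow> j < d \<Longrightarrow> a j < a i" and b: "\<And>i j. i < j \<Longrightarrow> j < d \<Longrightarrow> b j < b i"
  shows "toeplitz_minor d h a b =
    (\<Prod>i<d. if b i \<le> a i \<and> (Suc i < d \<longrightarrow> a (Suc i) < b i) then x ^ nat (a i - b i) else 0)"
proof -
  define C where "C = (\<lambda>i j. if b j \<le> a i \<and> (Suc i < d \<longrightarrow> a (Suc i) < b j)
      then x ^ nat (a i - b j) else 0)"
  define H where "H = mat d d (\<lambda>(i, j). h (a i - b j))"
  \<comment> \<open>Multiplication by \<open>U\<close> from the left performs the row operations.\<close>
  define U where "U = mat d d (\<lambda>(i, j). if j = i then 1 else if j = Suc i then - (x ^ nat (a i - a j)) else 0)"
  have U: "U \<in> carrier_mat d d" and H: "H \<in> carrier_mat d d" by (simp_all add: U_def H_def)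
  have "det U = prod_list (diag_mat U)"
    by (rule det_upper_triangular[OF _ U]) (auto simp: U_def upper_triangular_def)
  also have "\<dots> = 1" by (subst prod_list_diag_prod) (auto simp: U_def)
  finally have "toeplitz_minor d h a b = det (U * H)"
    using det_mult[OF U H] by (simp add: toeplitz_minor_def H_def)
  also have "U * H = mat d d (\<lambda>(i, j). C i j)"
  proof (rule eq_matI)
    fix i j assume "i < dim_row (mat d d (\<lambda>(i, j). C i j))" "j < dim_col (mat d d (\<lambda>(i, j). C i j))"
    then have i: "i < d" and j: "j < d" by auto
    have "(U * H) $$ (i, j) = (\<Sum>l = 0..<d. U $$ (i, l) * H $$ (l, j))"
      using i j by (simp add: scalar_prod_def U_def H_def)
    also have "\<dots> = (\<Sum>l\<in>{i, Suc i} \<inter> {0..<d}. U $$ (i, l) * H $$ (l, j))"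
      by (rule sum.mono_neutral_right) (use i in \<open>auto simp: U_def\<close>)
    also have "\<dots> = C i j"
    proof (cases "Suc i < d")
      case True
      then have "{i, Suc i} \<inter> {0..<d} = {i, Suc i}" by auto
      then have "(\<Sum>l\<in>{i, Suc i} \<inter> {0..<d}. U $$ (i, l) * H $$ (l, j))
          = h (a i - b j) - x ^ nat (a i - a (Suc i)) * h (a (Suc i) - b j)"
        using True j by (simp add: U_def H_def)
      also have "\<dots> = C i j"
      proof (cases "a (Suc i) < b j")
        case False
        then have "x ^ nat (a i - a (Suc i)) * x ^ nat (a (Suc i) - b j) = x ^ nat (a i - b j)"
          using a[of i "Suc i"] True by (simp flip: power_add nat_add_distrib)
        then show ?thesis using False True a[of i "Suc i"] by (simp add: C_def h)
      qed (use True in \<open>simp add: C_def h\<close>)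
      finally show ?thesis .
    next
      case False
      then have "{i, Suc i} \<inter> {0..<d} = {i}" using i by auto
      then show ?thesis using i j False by (simp add: U_def H_def C_def h)
    qed
    finally show "(U * H) $$ (i, j) = mat d d (\<lambda>(i, j). C i j) $$ (i, j)" using i j by simp
  qed (auto simp: U_def H_def)
  also have "det \<dots> = (\<Prod>i<d. C i i)"
  proof (rule det_no_inversions)
    fix i i' j j' assume i: "i < i'" "i' < d" "j' < j" "j < d"
    have "a i' \<le> a (Suc i)" using a[of "Suc i" i'] i by (cases "Suc i = i'") auto
    then show "C i j = 0 \<or> C i' j' = 0" using b[of j' j] i by (auto simp: C_def)
  qed
  finally show ?thesis by (simp add: C_def)
qed

section \<open>Super complete symmetric functions\<close>

text \<open>
  Equality modulo the ideal of series whose coefficients vanish at all divisors of the monomial \<open>m\<close>.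
  A coefficient at \<open>m\<close> can be computed modulo this ideal, which reduces infinite alphabets, infinite
  products and infinite sums to finite ones.
\<close>

definition agree :: "'v multiset \<Rightarrow> ('v, 'c) mps \<Rightarrow> ('v, 'c) mps \<Rightarrow> bool" where
  "agree m f g \<longleftrightarrow> (\<forall>k. k \<subseteq># m \<longrightarrow> mps_coeff f k = mps_coeff g k)"

lemma agreeD: "agree m f g \<Longrightarrow> mps_coeff f m = mps_coeff g m"
  by (simp add: agree_def)

lemma agree_refl [simp]: "agree m f f"
  by (simp add: agree_def)

lemma agree_mult:
  fixes f g :: "('v, 'c::comm_ring_1) mps"
  assumes f: "agree m f f'" and g: "agree m g g'"
  shows "agree m (f * g) (f' * g')"
  unfolding agree_def
proof (intro allI impI)
  fix k assume k: "k \<subseteq># m"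
  show "mps_coeff (f * g) k = mps_coeff (f' * g') k"
    unfolding mps_coeff_mult
  proof (rule sum.cong[OF refl])
    fix l assume "l \<in> {l. l \<subseteq># k}"
    then have "l \<subseteq># m" "k - l \<subseteq># m"
      using k by (auto intro: subset_mset.order_trans[OF _ k])
    then show "mps_coeff f l * mps_coeff g (k - l) = mps_coeff f' l * mps_coeff g' (k - l)"
      using f g by (simp add: agree_def)
  qed
qed

lemma agree_sum:
  fixes f :: "'i \<Rightarrow> ('v, 'c::comm_ring_1) mps"
  assumes "\<And>i. i \<in> I \<Longrightarrow> agree m (f i) (f' i)"
  shows "agree m (sum f I) (sum f' I)"
  using assms by (auto simp: agree_def mps_coeff_sum intro!: sum.cong)

lemma agree_prod:
  fixes f :: "'i \<Rightarrow> ('v, 'c::comm_ring_1) mps"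
  assumes "\<And>i. i \<in> I \<Longrightarrow> agree m (f i) (f' i)"
  shows "agree m (prod f I) (prod f' I)"
  using assms by (induction I rule: infinite_finite_induct) (auto intro: agree_mult)

lemma agree_det:
  fixes A :: "nat \<Rightarrow> nat \<Rightarrow> ('v, 'c::comm_ring_1) mps"
  assumes "\<And>i j. i < d \<Longrightarrow> j < d \<Longrightarrow> agree m (A i j) (B i j)"
  shows "agree m (det (mat d d (\<lambda>(i, j). A i j))) (det (mat d d (\<lambda>(i, j). B i j)))"
proof -
  have "det (mat d d (\<lambda>(i, j). A i j))
      = (\<Sum>p | p permutes {0..<d}. signof p * (\<Prod>i = 0..<d. A i (p i)))"
    for A :: "nat \<Rightarrow> nat \<Rightarrow> ('v, 'c) mps"
    by (subst det_def'[of _ d]) (auto intro!: sum.cong prod.cong dest: permutes_in_image)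
  then show ?thesis
    by (auto intro!: agree_sum agree_mult agree_prod assms dest: permutes_in_image)
qed

lemma agree_minor:
  fixes h :: "int \<Rightarrow> ('v, 'c::comm_ring_1) mps"
  assumes "\<And>k. agree m (h k) (h' k)"
  shows "agree m (toeplitz_minor d h a b) (toeplitz_minor d h' a b)"
  unfolding toeplitz_minor_def by (rule agree_det) (rule assms)

text \<open>
  For disjoint \<open>V0\<close> and \<open>V1\<close>: the monomials occurring in the product of \<open>1 / (1 - x)\<close> over the even letters \<open>V0\<close> and of \<open>1 + x\<close> over
  the odd letters \<open>V1\<close>; each of them occurs with coefficient \<open>1\<close>.
\<close>

definition admissible :: "'v set \<Rightarrow> 'v set \<Rightarrow> 'v multiset \<Rightarrow> bool" where
  "admissible V0 V1 m \<longleftrightarrow> set_mset m \<subseteq> V0 \<union> V1 \<and> (\<forall>v\<in>V1. count m v \<le> 1)"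

text \<open>
  For disjoint \<open>V0\<close> and \<open>V1\<close>, this is the super Schur function of the one-row shape \<open>(k)\<close>, extended
  by zero to negative \<open>k\<close>.
\<close>

definition super_complete :: "'v set \<Rightarrow> 'v set \<Rightarrow> int \<Rightarrow> ('v, 'c::comm_ring_1) mps" where
  "super_complete V0 V1 k = Abs_mps (\<lambda>m. of_bool (admissible V0 V1 m \<and> int (size m) = k))"

lemma super_complete_neg [simp]: "k < 0 \<Longrightarrow> super_complete V0 V1 k = 0"
  by (rule mps_eqI) (auto simp: super_complete_def)

lemma admissible_restrict:
  assumes "n \<subseteq># m"
  shows "admissible V0 V1 n \<longleftrightarrow> admissible (V0 \<inter> set_mset m) (V1 \<inter> set_mset m) n"
proof -
  have "count n v \<le> 1 \<longleftrightarrow> (v \<in># m \<longrightarrow> count n v \<le> 1)" for v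
    using mset_subset_eq_count[OF assms, of v] by (cases "v \<in># m") (auto simp: not_in_iff)
  then show ?thesis using set_mset_mono[OF assms] by (auto simp: admissible_def)
qed

lemma agree_super_complete:
  "agree m (super_complete V0 V1 k) (super_complete (V0 \<inter> set_mset m) (V1 \<inter> set_mset m) k)"
  by (simp add: agree_def super_complete_def admissible_restrict[of _ m V0 V1])

text \<open>
  A monomial in the union of two disjoint alphabets factors in only one way.
\<close>

lemma super_complete_mult_coeff:
  assumes disj: "(V0 \<union> V1) \<inter> (W0 \<union> W1) = {}"
  shows "mps_coeff (super_complete V0 V1 i * super_complete W0 W1 j) m =
    (of_bool (admissible (V0 \<union> W0) (V1 \<union> W1) m \<and>
       int (size {#v \<in># m. v \<in> V0 \<union> V1#}) = i \<and> int (size {#v \<in># m. v \<notin> V0 \<union> V1#}) = j) :: 'c::comm_ring_1)"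
proof -
  let ?k = "{#v \<in># m. v \<in> V0 \<union> V1#}"
  have sub: "?k \<subseteq># m" by (rule multiset_filter_subset)
  have diff: "m - ?k = {#v \<in># m. v \<notin> V0 \<union> V1#}"
    by (metis add_diff_cancel_left' multiset_partition)
  have unique: "k = ?k" if k: "k \<subseteq># m" "admissible V0 V1 k" "admissible W0 W1 (m - k)" for k
  proof (rule multiset_eqI)
    fix v
    have le: "count k v \<le> count m v" using mset_subset_eq_count[OF k(1)] .
    show "count k v = count ?k v"
    proof (cases "v \<in> V0 \<union> V1")
      case True
      then have "v \<notin># m - k" using k(3) disj by (auto simp: admissible_def)
      then have "count m v - count k v = 0" by (metis count_diff not_in_iff)
      then show ?thesis using True le by simp
    next
      case False
      then have "v \<notin># k" using k(2) by (auto simp: admissible_def)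
      then show ?thesis using False by (simp add: not_in_iff)
    qed
  qed
  have "mps_coeff (super_complete V0 V1 i * super_complete W0 W1 j) m
      = (\<Sum>k\<in>{?k}. mps_coeff (super_complete V0 V1 i) k * mps_coeff (super_complete W0 W1 j) (m - k) :: 'c)"
    unfolding mps_coeff_mult
  proof (intro sum.mono_neutral_right finite_submultisets ballI)
    fix k assume "k \<in> {k. k \<subseteq># m} - {?k}"
    then have "\<not> (admissible V0 V1 k \<and> admissible W0 W1 (m - k))" using unique by blast
    then show "mps_coeff (super_complete V0 V1 i) k * mps_coeff (super_complete W0 W1 j) (m - k) = (0::'c)"
      by (auto simp: super_complete_def)
  qed (use sub in simp)
  also have "\<dots> = mps_coeff (super_complete V0 V1 i) ?k *
      mps_coeff (super_complete W0 W1 j) {#v \<in># m. v \<notin> V0 \<union> V1#}"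
    by (simp only: diff sum.insert sum.empty finite.emptyI empty_iff not_False_eq_True add_0_right)
  also have "\<dots> = of_bool ((admissible V0 V1 ?k \<and> admissible W0 W1 {#v \<in># m. v \<notin> V0 \<union> V1#}) \<and>
       int (size ?k) = i \<and> int (size {#v \<in># m. v \<notin> V0 \<union> V1#}) = j)"
    by (auto simp: super_complete_def)
  also have "(admissible V0 V1 ?k \<and> admissible W0 W1 {#v \<in># m. v \<notin> V0 \<union> V1#}) \<longleftrightarrow>
      admissible (V0 \<union> W0) (V1 \<union> W1) m"
    unfolding admissible_def using disj by auto
  finally show ?thesis .
qed

lemma size_filter_split: "size {#v \<in># m. P v#} + size {#v \<in># m. \<not> P v#} = size m"
  by (metis multiset_partition size_union)

text \<open>
  The generating function of a disjoint union is the product of the generating functions, in the form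
  needed for a product of Toeplitz matrices: all nonzero summands have \<open>b \<le> k \<le> a\<close>.
\<close>

lemma super_complete_convolution:
  assumes disj: "(V0 \<union> V1) \<inter> (W0 \<union> W1) = {}" and K: "finite K" "{b..a} \<subseteq> K"
  shows "(\<Sum>k\<in>K. super_complete V0 V1 (a - k) * super_complete W0 W1 (k - b)) =
    (super_complete (V0 \<union> W0) (V1 \<union> W1) (a - b) :: ('v, 'c::comm_ring_1) mps)"
proof (rule mps_eqI)
  fix m :: "'v multiset"
  let ?s = "int (size {#v \<in># m. v \<in> V0 \<union> V1#})" and ?t = "int (size {#v \<in># m. v \<notin> V0 \<union> V1#})"
  let ?Q = "admissible (V0 \<union> W0) (V1 \<union> W1) m"
  have st: "?s + ?t = int (size m)"
    using size_filter_split[of "\<lambda>v. v \<in> V0 \<union> V1" m] by linarith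
  have "mps_coeff (\<Sum>k\<in>K. super_complete V0 V1 (a - k) * super_complete W0 W1 (k - b)) m
      = (\<Sum>k\<in>K. of_bool (?Q \<and> ?s = a - k \<and> ?t = k - b) :: 'c)"
    by (simp only: mps_coeff_sum super_complete_mult_coeff[OF disj])
  also have "\<dots> = (\<Sum>k\<in>K. if k = a - ?s then of_bool (?Q \<and> ?t = a - ?s - b) else 0)"
    by (rule sum.cong) auto
  also have "\<dots> = of_bool (?Q \<and> int (size m) = a - b)"
  proof (cases "?Q \<and> int (size m) = a - b")
    case True
    then have "a - ?s \<in> K" using st by (intro subsetD[OF K(2)]) auto
    then show ?thesis using True st K(1) by (simp add: sum.delta)
  next
    case False
    then have "\<not> (?Q \<and> ?t = a - ?s - b)" using st by auto
    then show ?thesis using False by (auto intro!: sum.neutral)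
  qed
  finally show "mps_coeff (\<Sum>k\<in>K. super_complete V0 V1 (a - k) * super_complete W0 W1 (k - b)) m =
    mps_coeff (super_complete (V0 \<union> W0) (V1 \<union> W1) (a - b) :: ('v, 'c) mps) m"
    by (simp add: super_complete_def)
qed

definition monomial :: "'v multiset \<Rightarrow> ('v, 'c::comm_ring_1) mps" where
  "monomial m = Abs_mps (\<lambda>k. of_bool (k = m))"

lemma monomial_empty [simp]: "monomial {#} = 1"
  by (rule mps_eqI) (simp add: monomial_def)

lemma monomial_add_mset: "monomial (add_mset v m) = mps_term 1 v * monomial m"
proof (rule mps_eqI)
  fix k
  have "(v \<in># k \<and> k - {#v#} = m) \<longleftrightarrow> k = add_mset v m" by (auto simp: insert_DiffM)
  then show "mps_coeff (monomial (add_mset v m)) k = mps_coeff (mps_term 1 v * monomial m) k"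
    by (auto simp: mps_coeff_term_mult monomial_def)
qed

lemma monomial_add: "monomial (m + n) = (monomial m * monomial n :: ('v, 'c::comm_ring_1) mps)"
  by (induction m) (simp_all add: monomial_add_mset mult.assoc)

lemma monomial_replicate: "monomial (replicate_mset n v) = (mps_term 1 v :: ('v, 'c::comm_ring_1) mps) ^ n"
  by (induction n) (simp_all add: monomial_add_mset)

lemma super_complete_empty: "super_complete {} {} k = of_bool (k = 0)"
  by (rule mps_eqI) (auto simp: super_complete_def admissible_def)

lemma super_complete_even_letter:
  "super_complete {v} {} k = (if k < 0 then 0 else (mps_term 1 v :: ('v, 'c::comm_ring_1) mps) ^ nat k)"
proof -
  have "set_mset m \<subseteq> {v} \<longleftrightarrow> m = replicate_mset (size m) v" for m :: "'v multiset"
  proof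
    assume "m = replicate_mset (size m) v"
    then have "set_mset m = set_mset (replicate_mset (size m) v)" by (rule arg_cong)
    then show "set_mset m \<subseteq> {v}" by (simp split: if_splits)
  qed (rule set_mset_subset_singletonD)
  then have "(set_mset m \<subseteq> {v} \<and> int (size m) = k) \<longleftrightarrow> (m = replicate_mset (nat k) v \<and> 0 \<le> k)"
    for m :: "'v multiset" by (metis nat_int of_nat_0_le_iff size_replicate_mset int_nat_eq)
  then show ?thesis
    by (auto intro!: mps_eqI simp: super_complete_def admissible_def monomial_def simp flip: monomial_replicate)
qed

lemma super_complete_odd_letter:
  "super_complete {} {v} k = (if k = 0 then 1 else if k = 1 then mps_term 1 v else 0)"
proof (rule mps_eqI)
  fix m :: "'a multiset"
  have "admissible {} {v} m \<longleftrightarrow> m = {#} \<or> m = {#v#}"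
  proof
    assume "admissible {} {v} m"
    then have m: "m = replicate_mset (size m) v" and le: "count m v \<le> 1"
      by (auto simp: admissible_def intro: set_mset_subset_singletonD)
    have "count m v = size m" using arg_cong[OF m, of "\<lambda>n. count n v"] by simp
    then have "size m = 0 \<or> size m = 1" using le by linarith
    then show "m = {#} \<or> m = {#v#}"
    proof
      assume "size m = 1"
      then show ?thesis using m by (simp add: numeral_eq_Suc)
    qed simp
  qed (auto simp: admissible_def)
  then show "mps_coeff (super_complete {} {v} k) m =
    mps_coeff (if k = 0 then 1 else if k = 1 then mps_term 1 v else 0) m"
    by (auto simp: super_complete_def mps_term_def)
qed

section \<open>Composition of minors\<close>

text \<open>
  The beta numbers of a shape, up to a constant shift.
\<close>

definition beta_number :: "(nat \<Rightarrow> nat) \<Rightarrow> nat \<Rightarrow> int" where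
  "beta_number lam i = int (lam i) - int i"

lemma beta_less:
  assumes "is_partition lam" and "i < j"
  shows "beta_number lam j < beta_number lam i"
  using assms antimonoD[of lam i j] by (auto simp: beta_number_def is_partition_def)

lemma antimono_on_beta:
  assumes "is_partition lam"
  shows "antimono_on A (beta_number lam)"
proof (rule monotone_onI)
  fix i j :: nat assume "i \<le> j"
  then show "beta_number lam j \<le> beta_number lam i"
    using beta_less[OF assms, of i j] by (cases "i = j") auto
qed

lemma dec_list_gap:
  assumes g: "g \<in> dec_lists d K" and "i \<le> j" and "j < d"
  shows "g ! j + int j \<le> g ! i + int i"
  using assms(2,3)
proof (induction j rule: dec_induct)
  case (step n)
  have "g ! Suc n < g ! n"
    using g step.prems by (auto simp: dec_lists_def sorted_wrt_iff_nth_less)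
  then show ?case using step by simp
qed simp

lemma antimono_on_dec_list:
  assumes "g \<in> dec_lists d K"
  shows "antimono_on {..<d} ((!) g)"
  by (rule monotone_onI) (use dec_list_gap[OF assms] in fastforce)

text \<open>
  The Cauchy--Binet formula for the product of the Toeplitz matrices of two disjoint alphabets. By
  the vanishing of minors only the choices of indices between \<open>beta_number mu\<close> and
  \<open>beta_number lam\<close> contribute, and those are the sequences \<open>beta_number nu\<close> of the intermediate partitions.
\<close>

lemma minor_compose:
  fixes lam mu :: "nat \<Rightarrow> nat"
  assumes disj: "(V0 \<union> V1) \<inter> (W0 \<union> W1) = {}"
    and lam: "is_partition lam" and mu: "is_partition mu"
    and mu_lam: "mu \<le> lam" and len: "\<And>i. d \<le> i \<Longrightarrow> lam i = 0"
  shows "(\<Sum>nu | is_partition nu \<and> mu \<le> nu \<and> nu \<le> lam.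
      toeplitz_minor d (super_complete V0 V1) (beta_number lam) (beta_number nu) *
      toeplitz_minor d (super_complete W0 W1) (beta_number nu) (beta_number mu)) =
    (toeplitz_minor d (super_complete (V0 \<union> W0) (V1 \<union> W1)) (beta_number lam) (beta_number mu) :: ('v, 'c::comm_ring_1) mps)"
proof -
  \<comment> \<open>A window that contains all values \<open>beta_number nu i\<close> with \<open>nu \<le> lam\<close> and \<open>i < d\<close>.\<close>
  define K where "K = {- int d..int (lam 0)}"
  have K: "finite K" by (simp add: K_def)
  let ?m = "\<lambda>g. toeplitz_minor d (super_complete V0 V1) (beta_number lam) ((!) g) *
      toeplitz_minor d (super_complete W0 W1) ((!) g) (beta_number mu) :: ('v, 'c) mps"
  let ?G = "{g \<in> dec_lists d K. \<forall>i<d. beta_number mu i \<le> g ! i \<and> g ! i \<le> beta_number lam i}"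
  have lam0: "lam i \<le> lam 0" for i using lam antimonoD[of lam 0 i] by (simp add: is_partition_def)
  have entry: "(\<Sum>k\<in>K. super_complete V0 V1 (beta_number lam i - k) * super_complete W0 W1 (k - beta_number mu j)) =
      (super_complete (V0 \<union> W0) (V1 \<union> W1) (beta_number lam i - beta_number mu j) :: ('v, 'c) mps)"
    if "i < d" "j < d" for i j
    by (rule super_complete_convolution[OF disj K])
       (use that lam0[of i] in \<open>auto simp: K_def beta_number_def\<close>)
  have "toeplitz_minor d (super_complete (V0 \<union> W0) (V1 \<union> W1)) (beta_number lam) (beta_number mu) =
    det (mat d d (\<lambda>(i, j). \<Sum>k\<in>K. super_complete V0 V1 (beta_number lam i - k) * super_complete W0 W1 (k - beta_number mu j)) :: ('v, 'c) mps mat)"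
    unfolding toeplitz_minor_def by (intro arg_cong[of _ _ det] cong_mat) (simp_all add: entry)
  also have "\<dots> = (\<Sum>g\<in>dec_lists d K. ?m g)"
    unfolding cauchy_binet[OF K] toeplitz_minor_def ..
  also have "\<dots> = (\<Sum>g\<in>?G. ?m g)"
  proof (rule sum.mono_neutral_right)
    show "\<forall>g\<in>dec_lists d K - ?G. ?m g = 0"
    proof
      fix g assume g: "g \<in> dec_lists d K - ?G"
      then obtain i where i: "i < d" "g ! i < beta_number mu i \<or> beta_number lam i < g ! i" by force
      have dec: "antimono_on {..<d} ((!) g)" using g by (intro antimono_on_dec_list) auto
      have "toeplitz_minor d (super_complete V0 V1) (beta_number lam) ((!) g) = (0 :: ('v, 'c) mps)" if "beta_number lam i < g ! i"
        by (rule minor_eq_0[OF _ antimono_on_beta[OF lam] dec i(1) that]) simp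
      moreover have "toeplitz_minor d (super_complete W0 W1) ((!) g) (beta_number mu) = (0 :: ('v, 'c) mps)"
        if "g ! i < beta_number mu i"
        by (rule minor_eq_0[OF _ dec antimono_on_beta[OF mu] i(1) that]) simp
      ultimately show "?m g = 0" using i(2) by auto
    qed
  qed (auto simp: finite_dec_lists[OF K])
  also have "\<dots> = (\<Sum>nu | is_partition nu \<and> mu \<le> nu \<and> nu \<le> lam.
      toeplitz_minor d (super_complete V0 V1) (beta_number lam) (beta_number nu) *
      toeplitz_minor d (super_complete W0 W1) (beta_number nu) (beta_number mu))"
  proof (rule sum.reindex_bij_witness[of _ "\<lambda>nu. map (beta_number nu) [0..<d]"
        "\<lambda>g i. if i < d then nat (g ! i + int i) else 0"])
    fix g assume "g \<in> ?G"
    then have g: "g \<in> dec_lists d K" and mu_g: "\<And>i. i < d \<Longrightarrow> int (mu i) \<le> g ! i + int i"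
      and g_lam: "\<And>i. i < d \<Longrightarrow> g ! i + int i \<le> int (lam i)"
      by (auto simp: beta_number_def algebra_simps)
    let ?nu = "\<lambda>i. if i < d then nat (g ! i + int i) else 0"
    have nn: "0 \<le> g ! i + int i" if "i < d" for i using mu_g[OF that] by simp
    have nu: "beta_number ?nu i = g ! i" if "i < d" for i using that nn by (simp add: beta_number_def)
    have len_g: "length g = d" using g by (simp add: dec_lists_def)
    show "map (beta_number ?nu) [0..<d] = g"
      by (rule nth_equalityI) (simp_all add: len_g nu)
    have "antimono ?nu"
      using dec_list_gap[OF g] nn by (auto simp: antimono_def intro!: nat_mono)
    then have "is_partition ?nu"
      by (auto simp: is_partition_def intro: finite_subset[of _ "{..<d}"])
    moreover have "mu i \<le> ?nu i" for i
    proof (cases "i < d")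
      case False
      then have "mu i = 0" using le_funD[OF mu_lam, of i] len[of i] by simp
      then show ?thesis by simp
    qed (use mu_g[of i] in simp)
    moreover have "?nu i \<le> lam i" for i using g_lam[of i] by (auto simp: nat_le_iff)
    ultimately show "?nu \<in> {nu. is_partition nu \<and> mu \<le> nu \<and> nu \<le> lam}"
      by (simp add: le_fun_def)
    have "toeplitz_minor d (super_complete V0 V1) (beta_number lam) (beta_number ?nu) = (toeplitz_minor d (super_complete V0 V1) (beta_number lam) ((!) g) :: ('v, 'c) mps)"
      "toeplitz_minor d (super_complete W0 W1) (beta_number ?nu) (beta_number mu) = (toeplitz_minor d (super_complete W0 W1) ((!) g) (beta_number mu) :: ('v, 'c) mps)"
      by (rule minor_cong; simp add: nu)+
    then show "toeplitz_minor d (super_complete V0 V1) (beta_number lam) (beta_number ?nu) *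
        toeplitz_minor d (super_complete W0 W1) (beta_number ?nu) (beta_number mu) = ?m g" by simp
  next
    fix nu assume nu: "nu \<in> {nu. is_partition nu \<and> mu \<le> nu \<and> nu \<le> lam}"
    then have le: "mu i \<le> nu i" "nu i \<le> lam i" for i by (auto simp: le_fun_def)
    show "(\<lambda>i. if i < d then nat (map (beta_number nu) [0..<d] ! i + int i) else 0) = nu"
    proof
      fix i
      show "(if i < d then nat (map (beta_number nu) [0..<d] ! i + int i) else 0) = nu i"
        using le(2)[of i] len[of i] by (cases "i < d") (auto simp: beta_number_def)
    qed
    have "beta_number nu i \<in> K" if "i < d" for i
      using order_trans[OF le(2) lam0, of i] that by (simp add: K_def beta_number_def)
    then have "map (beta_number nu) [0..<d] \<in> dec_lists d K"
      using nu beta_less[of nu] by (auto simp: dec_lists_def sorted_wrt_iff_nth_less)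
    then show "map (beta_number nu) [0..<d] \<in> ?G" using le by (auto simp: beta_number_def)
  qed
  finally show ?thesis by simp
qed

section \<open>Removing the largest letter of a tableau\<close>

text \<open>
  Fillings in which equal letters may repeat along rows (even letters) or along columns (odd letters).
  The odd version describes the transposes of ordinary semistandard tableaux without transposing the
  shape, so that both parities can be treated at once. The order of the letters is
  given by the separate key \<open>f\<close> so that a subset of an alphabet keeps the order of the whole
  alphabet.
\<close>

definition tableaux ::
  "('v \<Rightarrow> nat) \<Rightarrow> bool \<Rightarrow> 'v set \<Rightarrow> (nat \<Rightarrow> nat) \<Rightarrow> (nat \<Rightarrow> nat) \<Rightarrow> (nat \<times> nat \<Rightarrow> 'v) set" where
  "tableaux f is_odd W lam mu = {T \<in> skew_diagram lam mu \<rightarrow>\<^sub>E W.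
     (\<forall>i j j'. (i, j) \<in> skew_diagram lam mu \<and> (i, j') \<in> skew_diagram lam mu \<and> j < j' \<longrightarrow>
        f (T (i, j)) < f (T (i, j')) \<or> \<not> is_odd \<and> T (i, j) = T (i, j')) \<and>
     (\<forall>i i' j. (i, j) \<in> skew_diagram lam mu \<and> (i', j) \<in> skew_diagram lam mu \<and> i < i' \<longrightarrow>
        f (T (i, j)) < f (T (i', j)) \<or> is_odd \<and> T (i, j) = T (i', j))}"

definition tableau_content :: "(nat \<Rightarrow> nat) \<Rightarrow> (nat \<Rightarrow> nat) \<Rightarrow> (nat \<times> nat \<Rightarrow> 'v) \<Rightarrow> 'v multiset" where
  "tableau_content lam mu T = image_mset T (mset_set (skew_diagram lam mu))"

text \<open>
  For partitions \<open>rho \<le> lam\<close>: the cells between the two shapes form a vertical strip, if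
  \<open>is_odd\<close> holds, or a horizontal strip otherwise. These are the sets of cells that one letter can fill.
\<close>

definition strip :: "bool \<Rightarrow> (nat \<Rightarrow> nat) \<Rightarrow> (nat \<Rightarrow> nat) \<Rightarrow> bool" where
  "strip is_odd lam rho \<longleftrightarrow> (\<forall>i. if is_odd then lam i \<le> Suc (rho i) else lam (Suc i) \<le> rho i)"

definition extend_tableau ::
  "'v \<Rightarrow> (nat \<Rightarrow> nat) \<Rightarrow> (nat \<Rightarrow> nat) \<Rightarrow> (nat \<Rightarrow> nat) \<Rightarrow> (nat \<times> nat \<Rightarrow> 'v) \<Rightarrow> (nat \<times> nat \<Rightarrow> 'v)" where
  "extend_tableau v lam mu rho T = restrict (\<lambda>c. if c \<in> skew_diagram rho mu then T c else v) (skew_diagram lam mu)"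

text \<open>
  In each row the copies of the largest letter \<open>v\<close> form a final segment; the smaller shape ends
  where that segment starts.
\<close>

definition peeled_shape ::
  "'v \<Rightarrow> (nat \<Rightarrow> nat) \<Rightarrow> (nat \<Rightarrow> nat) \<Rightarrow> (nat \<times> nat \<Rightarrow> 'v) \<Rightarrow> (nat \<Rightarrow> nat)" where
  "peeled_shape v lam mu T i = (LEAST j. mu i \<le> j \<and> (j < lam i \<longrightarrow> T (i, j) = v))"

lemma in_skew_diagram: "(i, j) \<in> skew_diagram lam mu \<longleftrightarrow> mu i \<le> j \<and> j < lam i"
  by (simp add: skew_diagram_def)

lemma strip_lessD:
  assumes "strip False lam rho" "is_partition lam" "i < i'"
  shows "lam i' \<le> rho i"
  using assms antimonoD[of lam "Suc i" i'] by (auto simp: strip_def is_partition_def intro: order_trans)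

lemma finite_tableaux:
  assumes "is_partition lam" "finite W"
  shows "finite (tableaux f is_odd W lam mu)"
proof (rule finite_subset)
  show "tableaux f is_odd W lam mu \<subseteq> skew_diagram lam mu \<rightarrow>\<^sub>E W" by (auto simp: tableaux_def)
qed (simp add: finite_PiE finite_skew_diagram assms)

text \<open>
  Filling a strip with a letter larger than all others creates no conflict: two cells of a horizontal
  strip never share a column, and two cells of a vertical strip never share a row.
\<close>

lemma extend_tableau_in:
  assumes lam: "is_partition lam" and rho: "is_partition rho" "rho \<le> lam" "strip is_odd lam rho"
    and f: "\<And>w. w \<in> W \<Longrightarrow> f w < f v"
    and T: "T \<in> tableaux f is_odd W rho mu"
  shows "extend_tableau v lam mu rho T \<in> tableaux f is_odd (insert v W) lam mu"
proof -
  let ?L = "skew_diagram lam mu" and ?R = "skew_diagram rho mu"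
  let ?E = "extend_tableau v lam mu rho T"
  have TW: "T c \<in> W" if "c \<in> ?R" for c using T that by (auto simp: tableaux_def)
  have RL: "c \<in> ?L" if "c \<in> ?R" for c
    using that le_funD[OF rho(2)] by (cases c) (auto simp: in_skew_diagram intro: less_le_trans)
  have E: "?E c = (if c \<in> ?R then T c else v)" if "c \<in> ?L" for c
    using that by (simp add: extend_tableau_def)
  have row: "f (T (i, j)) < f (T (i, j')) \<or> \<not> is_odd \<and> T (i, j) = T (i, j')"
    if "(i, j) \<in> ?R" "(i, j') \<in> ?R" "j < j'" for i j j'
    using T that unfolding tableaux_def by blast
  have col: "f (T (i, j)) < f (T (i', j)) \<or> is_odd \<and> T (i, j) = T (i', j)"
    if "(i, j) \<in> ?R" "(i', j) \<in> ?R" "i < i'" for i i' j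
    using T that unfolding tableaux_def by blast
  have "f (?E (i, j)) < f (?E (i, j')) \<or> \<not> is_odd \<and> ?E (i, j) = ?E (i, j')"
    if c: "(i, j) \<in> ?L" "(i, j') \<in> ?L" "j < j'" for i j j'
  proof (cases "(i, j') \<in> ?R")
    case True
    then have "(i, j) \<in> ?R" using c by (simp add: in_skew_diagram)
    then show ?thesis using row[OF _ True c(3)] True c E by simp
  next
    case False
    have "\<not> is_odd" if "(i, j) \<notin> ?R"
    proof
      assume is_odd
      then have "lam i \<le> Suc (rho i)" using rho(3) by (simp add: strip_def)
      then show False using c that by (auto simp: in_skew_diagram)
    qed
    then show ?thesis using False c E f TW by auto
  qed
  moreover have "f (?E (i, j)) < f (?E (i', j)) \<or> is_odd \<and> ?E (i, j) = ?E (i', j)"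
    if c: "(i, j) \<in> ?L" "(i', j) \<in> ?L" "i < i'" for i i' j
  proof (cases "(i', j) \<in> ?R")
    case True
    have "rho i' \<le> rho i" using rho(1) c by (simp add: is_partition_def antimonoD)
    then have "(i, j) \<in> ?R" using True c by (simp add: in_skew_diagram)
    then show ?thesis using col[OF _ True c(3)] True c E by simp
  next
    case False
    have is_odd if "(i, j) \<notin> ?R"
    proof (rule ccontr)
      assume "\<not> is_odd"
      then have "lam i' \<le> rho i" using strip_lessD[of lam rho i i'] rho(3) lam c by simp
      then show False using c that by (auto simp: in_skew_diagram)
    qed
    then show ?thesis using False c E f TW by auto
  qed
  moreover have "?E \<in> ?L \<rightarrow>\<^sub>E insert v W"
    using TW by (auto simp: extend_tableau_def)
  ultimately show ?thesis unfolding tableaux_def by blast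
qed

text \<open>
  Since \<open>v\<close> is the largest letter, a cell to the right of or below a copy of \<open>v\<close> contains \<open>v\<close> as well.
  Hence the other cells form a skew diagram, and the repetition rule for \<open>v\<close> makes the removed cells
  a strip.
\<close>

lemma peeled_shape:
  assumes lam: "is_partition lam" and mu: "is_partition mu" and mu_lam: "mu \<le> lam"
    and f: "\<And>w. w \<in> W \<Longrightarrow> f w < f v"
    and T: "T \<in> tableaux f is_odd (insert v W) lam mu"
  defines "rho \<equiv> peeled_shape v lam mu T"
  shows "is_partition rho" "mu \<le> rho" "rho \<le> lam" "strip is_odd lam rho"
    "restrict T (skew_diagram rho mu) \<in> tableaux f is_odd W rho mu"
    "extend_tableau v lam mu rho T = T"
proof -
  let ?L = "skew_diagram lam mu" and ?R = "skew_diagram rho mu"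
  have T_ext: "T \<in> ?L \<rightarrow>\<^sub>E insert v W" using T by (simp add: tableaux_def)
  then have T_in: "T c \<in> insert v W" if "c \<in> ?L" for c using that by auto
  have max: "\<not> f v < f (T c)" if "c \<in> ?L" for c
    using T_in[OF that] f[of "T c"] by auto
  have row: "f (T (i, j)) < f (T (i, j')) \<or> \<not> is_odd \<and> T (i, j) = T (i, j')"
    if "(i, j) \<in> ?L" "(i, j') \<in> ?L" "j < j'" for i j j'
    using T that unfolding tableaux_def by blast
  have col: "f (T (i, j)) < f (T (i', j)) \<or> is_odd \<and> T (i, j) = T (i', j)"
    if "(i, j) \<in> ?L" "(i', j) \<in> ?L" "i < i'" for i i' j
    using T that unfolding tableaux_def by blast
  have least: "mu i \<le> rho i \<and> (rho i < lam i \<longrightarrow> T (i, rho i) = v)" for i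
    unfolding rho_def peeled_shape_def
    by (rule LeastI[of _ "lam i"]) (use le_funD[OF mu_lam] in auto)
  have before: "T (i, j) \<noteq> v" if "mu i \<le> j" "j < rho i" for i j
    using not_less_Least[OF that(2)[unfolded rho_def peeled_shape_def]] that(1) by simp
  have le: "rho i \<le> lam i" for i
    unfolding rho_def peeled_shape_def
    by (rule Least_le) (use le_funD[OF mu_lam] in auto)
  have after: "T (i, j) = v" if "rho i \<le> j" "j < lam i" for i j
  proof (cases "j = rho i")
    case False
    have "(i, rho i) \<in> ?L" "(i, j) \<in> ?L" using least[of i] that by (auto simp: in_skew_diagram)
    then show ?thesis using row[of i "rho i" j] max[of "(i, j)"] least[of i] that False by auto
  qed (use least that in auto)
  show "mu \<le> rho" "rho \<le> lam" using least le by (auto simp: le_fun_def)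
  have lam_anti: "lam i' \<le> lam i" and mu_anti: "mu i' \<le> mu i" if "i \<le> i'" for i i'
    using lam mu that by (auto simp: is_partition_def antimonoD)
  have "rho i' \<le> rho i" if "i < i'" for i i'
  proof (rule ccontr)
    assume "\<not> rho i' \<le> rho i"
    then have lt: "rho i < rho i'" by simp
    then have c: "(i, rho i) \<in> ?L" "(i', rho i) \<in> ?L"
      using least[of i] le[of i'] lam_anti[of i i'] mu_anti[of i i'] that
      by (auto simp: in_skew_diagram)
    have "T (i, rho i) = v" using least[of i] c by (simp add: in_skew_diagram)
    then have "T (i', rho i) = v" using col[OF c that] max[OF c(2)] by auto
    then show False using before[of i' "rho i"] lt c by (simp add: in_skew_diagram)
  qed
  then have "antimono rho" by (metis antimonoI le_neq_implies_less order_refl)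
  moreover have "{i. rho i \<noteq> 0} \<subseteq> {i. lam i \<noteq> 0}"
  proof
    fix i assume "i \<in> {i. rho i \<noteq> 0}"
    then show "i \<in> {i. lam i \<noteq> 0}" using le[of i] by simp
  qed
  ultimately show "is_partition rho"
    using lam by (auto simp: is_partition_def intro: finite_subset)
  show "strip is_odd lam rho"
    unfolding strip_def
  proof
    fix i
    show "if is_odd then lam i \<le> Suc (rho i) else lam (Suc i) \<le> rho i"
    proof (cases is_odd)
      case True
      have "\<not> Suc (rho i) < lam i"
      proof
        assume lt: "Suc (rho i) < lam i"
        then have "(i, rho i) \<in> ?L" "(i, Suc (rho i)) \<in> ?L"
          using least[of i] by (auto simp: in_skew_diagram)
        then show False using row[of i "rho i" "Suc (rho i)"] True after[of i] lt by simp
      qed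
      then show ?thesis using True by simp
    next
      case False
      have "\<not> rho i < lam (Suc i)"
      proof
        assume lt: "rho i < lam (Suc i)"
        then have c: "(i, rho i) \<in> ?L" "(Suc i, rho i) \<in> ?L"
          using least[of i] lam_anti[of i "Suc i"] mu_anti[of i "Suc i"] by (auto simp: in_skew_diagram)
        then have "T (i, rho i) = v" using least[of i] by (simp add: in_skew_diagram)
        then show False using col[of i "rho i" "Suc i"] c False max[OF c(2)] by auto
      qed
      then show ?thesis using False by simp
    qed
  qed
  have RL: "c \<in> ?L" if "c \<in> ?R" for c
    using that le by (cases c) (auto simp: in_skew_diagram intro: less_le_trans)
  have "T c \<in> W" if "c \<in> ?R" for c
    using that T_in[OF RL[OF that]] before by (cases c) (auto simp: in_skew_diagram)
  then show "restrict T ?R \<in> tableaux f is_odd W rho mu"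
    unfolding tableaux_def using row[OF RL RL] col[OF RL RL] by auto
  show "extend_tableau v lam mu rho T = T"
  proof
    fix c
    show "extend_tableau v lam mu rho T c = T c"
    proof (cases "c \<in> ?L")
      case True
      obtain i j where "c = (i, j)" by (cases c)
      then show ?thesis using True after[of i j] by (auto simp: extend_tableau_def in_skew_diagram)
    next
      case False
      then show ?thesis using PiE_arb[OF T_ext False] by (simp add: extend_tableau_def)
    qed
  qed
qed

lemma peeled_shape_extend_tableau:
  assumes rho: "mu \<le> rho" "rho \<le> lam"
    and f: "\<And>w. w \<in> W \<Longrightarrow> f w < f v"
    and T: "T \<in> tableaux f is_odd W rho mu"
  shows "peeled_shape v lam mu (extend_tableau v lam mu rho T) = rho"
    "restrict (extend_tableau v lam mu rho T) (skew_diagram rho mu) = T"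
proof -
  have T_ext: "T \<in> skew_diagram rho mu \<rightarrow>\<^sub>E W" using T by (simp add: tableaux_def)
  have RL: "c \<in> skew_diagram lam mu" if "c \<in> skew_diagram rho mu" for c
    using that le_funD[OF rho(2)] by (cases c) (auto simp: in_skew_diagram intro: less_le_trans)
  show "peeled_shape v lam mu (extend_tableau v lam mu rho T) = rho"
  proof
    fix i
    show "peeled_shape v lam mu (extend_tableau v lam mu rho T) i = rho i"
      unfolding peeled_shape_def
    proof (rule Least_equality)
      show "mu i \<le> rho i \<and> (rho i < lam i \<longrightarrow> extend_tableau v lam mu rho T (i, rho i) = v)"
        using le_funD[OF rho(1), of i] by (auto simp: extend_tableau_def in_skew_diagram)
      fix j assume j: "mu i \<le> j \<and> (j < lam i \<longrightarrow> extend_tableau v lam mu rho T (i, j) = v)"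
      show "rho i \<le> j"
      proof (rule ccontr)
        assume "\<not> rho i \<le> j"
        then have c: "(i, j) \<in> skew_diagram rho mu" using j by (simp add: in_skew_diagram)
        then have "T (i, j) = v"
          using j RL[OF c] by (auto simp: extend_tableau_def in_skew_diagram)
        moreover have "T (i, j) \<in> W" using T_ext c by auto
        ultimately show False using f[of v] by simp
      qed
    qed
  qed
  show "restrict (extend_tableau v lam mu rho T) (skew_diagram rho mu) = T"
  proof
    fix c
    show "restrict (extend_tableau v lam mu rho T) (skew_diagram rho mu) c = T c"
      using RL[of c] PiE_arb[OF T_ext, of c] by (cases "c \<in> skew_diagram rho mu") (auto simp: extend_tableau_def)
  qed
qed

lemma content_extend_tableau:
  assumes "is_partition lam" "mu \<le> rho" "rho \<le> lam"
  shows "tableau_content lam mu (extend_tableau v lam mu rho T) =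
    tableau_content rho mu T + replicate_mset (card (skew_diagram lam rho)) v"
proof -
  let ?E = "extend_tableau v lam mu rho T"
  have L: "skew_diagram lam mu = skew_diagram rho mu \<union> skew_diagram lam rho"
    using le_funD[OF assms(2)] le_funD[OF assms(3)]
    by (auto simp: skew_diagram_def intro: order_trans less_le_trans)
  have disj: "skew_diagram rho mu \<inter> skew_diagram lam rho = {}" by (auto simp: skew_diagram_def)
  have fin: "finite (skew_diagram lam mu)" using assms(1) by (rule finite_skew_diagram)
  then have fin': "finite (skew_diagram rho mu)" "finite (skew_diagram lam rho)"
    unfolding L by simp_all
  have "tableau_content lam mu ?E = image_mset ?E (mset_set (skew_diagram rho mu)) +
      image_mset ?E (mset_set (skew_diagram lam rho))"
    unfolding tableau_content_def L mset_set_Union[OF fin' disj] by simp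
  also have "image_mset ?E (mset_set (skew_diagram rho mu)) = tableau_content rho mu T"
    unfolding tableau_content_def using fin' L
    by (intro image_mset_cong) (auto simp: extend_tableau_def)
  also have "image_mset ?E (mset_set (skew_diagram lam rho)) =
      image_mset (\<lambda>_. v) (mset_set (skew_diagram lam rho))"
    using fin' L disj by (intro image_mset_cong) (auto simp: extend_tableau_def)
  also have "\<dots> = replicate_mset (card (skew_diagram lam rho)) v"
    by (simp add: image_mset_const_eq)
  finally show ?thesis .
qed

text \<open>
  The branching rule: a tableau is a tableau in the smaller letters together with the strip that the
  largest letter fills. It is stated for an arbitrary weight of the content.
\<close>

lemma sum_tableaux_peel:
  fixes x :: "'v multiset \<Rightarrow> 'r::comm_monoid_add"
  assumes lam: "is_partition lam" and mu: "is_partition mu" and mu_lam: "mu \<le> lam"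
    and W: "finite W" and f: "\<And>w. w \<in> W \<Longrightarrow> f w < f v"
  shows "(\<Sum>T\<in>tableaux f is_odd (insert v W) lam mu. x (tableau_content lam mu T)) =
    (\<Sum>rho | is_partition rho \<and> mu \<le> rho \<and> rho \<le> lam.
      if strip is_odd lam rho
      then \<Sum>T\<in>tableaux f is_odd W rho mu. x (tableau_content rho mu T + replicate_mset (card (skew_diagram lam rho)) v)
      else 0)"
proof -
  let ?P = "{rho. is_partition rho \<and> mu \<le> rho \<and> rho \<le> lam}"
  let ?S = "{rho \<in> ?P. strip is_odd lam rho}"
  have fin: "finite ?P"
  proof (rule finite_subset)
    define N where "N = {i. lam i \<noteq> 0}"
    have N: "finite N" using lam by (simp add: N_def is_partition_def)
    \<comment> \<open>A partition below \<open>lam\<close> is a function with finite support and bounded values.\<close>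
    let ?F = "{r. \<forall>i. (i \<in> N \<longrightarrow> r i \<in> {..lam 0}) \<and> (i \<notin> N \<longrightarrow> r i = 0)}"
    show "finite ?F" using N by (intro finite_set_of_finite_funs) auto
    show "?P \<subseteq> ?F"
    proof (intro subsetI CollectI allI)
      fix r i assume "r \<in> ?P"
      then have "r i \<le> lam i" by (simp add: le_fun_def)
      moreover have "lam i \<le> lam 0" using lam by (simp add: is_partition_def antimonoD)
      ultimately show "(i \<in> N \<longrightarrow> r i \<in> {..lam 0}) \<and> (i \<notin> N \<longrightarrow> r i = 0)" by (auto simp: N_def)
    qed
  qed
  have "(\<Sum>T\<in>tableaux f is_odd (insert v W) lam mu. x (tableau_content lam mu T)) =
    (\<Sum>(rho, T)\<in>(SIGMA rho:?S. tableaux f is_odd W rho mu).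
      x (tableau_content rho mu T + replicate_mset (card (skew_diagram lam rho)) v))"
  proof (rule sum.reindex_bij_witness[of _ "\<lambda>(rho, T). extend_tableau v lam mu rho T"
        "\<lambda>T. (peeled_shape v lam mu T, restrict T (skew_diagram (peeled_shape v lam mu T) mu))"])
    fix T assume T: "T \<in> tableaux f is_odd (insert v W) lam mu"
    note P = peeled_shape[OF lam mu mu_lam f T]
    let ?rho = "peeled_shape v lam mu T"
    have ext: "extend_tableau v lam mu ?rho (restrict T (skew_diagram ?rho mu)) = T"
    proof -
      have "extend_tableau v lam mu ?rho (restrict T (skew_diagram ?rho mu)) = extend_tableau v lam mu ?rho T"
        by (simp add: extend_tableau_def restrict_def if_distrib cong: if_cong)
      then show ?thesis using P(6) by simp
    qed
    show "(\<lambda>(rho, T). extend_tableau v lam mu rho T)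
        (?rho, restrict T (skew_diagram ?rho mu)) = T"
      using ext by simp
    show "(?rho, restrict T (skew_diagram ?rho mu)) \<in> (SIGMA rho:?S. tableaux f is_odd W rho mu)"
      using P by simp
    show "(case (?rho, restrict T (skew_diagram ?rho mu)) of (rho, T) \<Rightarrow>
        x (tableau_content rho mu T + replicate_mset (card (skew_diagram lam rho)) v)) = x (tableau_content lam mu T)"
      using content_extend_tableau[OF lam P(2,3), of v "restrict T (skew_diagram ?rho mu)"] ext by simp
  next
    fix y assume "y \<in> (SIGMA rho:?S. tableaux f is_odd W rho mu)"
    then obtain rho T where y: "y = (rho, T)" and rho: "is_partition rho" "mu \<le> rho" "rho \<le> lam"
      "strip is_odd lam rho" and T: "T \<in> tableaux f is_odd W rho mu" by auto
    show "(peeled_shape v lam mu (case y of (rho, T) \<Rightarrow> extend_tableau v lam mu rho T),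
        restrict (case y of (rho, T) \<Rightarrow> extend_tableau v lam mu rho T)
          (skew_diagram (peeled_shape v lam mu (case y of (rho, T) \<Rightarrow> extend_tableau v lam mu rho T)) mu)) = y"
      using peeled_shape_extend_tableau[OF rho(2,3) f T] by (simp add: y)
    show "(case y of (rho, T) \<Rightarrow> extend_tableau v lam mu rho T) \<in> tableaux f is_odd (insert v W) lam mu"
      using extend_tableau_in[OF lam rho(1,3,4) f T] by (simp add: y)
  qed
  also have "\<dots> = (\<Sum>rho\<in>?S. \<Sum>T\<in>tableaux f is_odd W rho mu.
      x (tableau_content rho mu T + replicate_mset (card (skew_diagram lam rho)) v))"
    using finite_subset[OF _ fin, of ?S] W by (subst sum.Sigma) (auto simp: finite_tableaux)
  also have "\<dots> = (\<Sum>rho\<in>?P. if strip is_odd lam rho then \<Sum>T\<in>tableaux f is_odd W rho mu.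
      x (tableau_content rho mu T + replicate_mset (card (skew_diagram lam rho)) v) else 0)"
    using fin by (subst sum.inter_filter) auto
  finally show ?thesis .
qed

section \<open>The super Jacobi--Trudi identity\<close>

text \<open>
  The complete functions of an alphabet of one parity, so that both parities share one induction.
\<close>

abbreviation letters :: "bool \<Rightarrow> 'v set \<Rightarrow> int \<Rightarrow> ('v, 'c::comm_ring_1) mps" where
  "letters is_odd W \<equiv> super_complete (if is_odd then {} else W) (if is_odd then W else {})"

lemma card_skew_diagram:
  assumes "\<And>i. d \<le> i \<Longrightarrow> lam i = 0"
  shows "card (skew_diagram lam rho) = (\<Sum>i<d. lam i - rho i)"
proof -
  have "i < d" if "j < lam i" for i j
    using assms[of i] that by (cases "d \<le> i") auto
  then have "skew_diagram lam rho = (SIGMA i:{..<d}. {rho i..<lam i})"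
    by (auto simp: skew_diagram_def)
  then show ?thesis by simp
qed

text \<open>
  A single variable moves between shapes exactly along strips. In the last row the condition on
  a horizontal strip is automatic because \<open>lam d = 0\<close>, which matches the missing next row of the
  matrix.
\<close>

lemma minor_letter:
  assumes lam: "is_partition lam" and rho: "is_partition rho" and le: "rho \<le> lam"
    and len: "\<And>i. d \<le> i \<Longrightarrow> lam i = 0"
  shows "toeplitz_minor d (letters is_odd {v}) (beta_number lam) (beta_number rho) =
    (if strip is_odd lam rho then monomial (replicate_mset (card (skew_diagram lam rho)) v)
     else 0 :: ('v, 'c::comm_ring_1) mps)"
proof -
  let ?x = "mps_term 1 v :: ('v, 'c) mps"
  have diff: "beta_number lam i - beta_number rho i = int (lam i - rho i)" for i
    using le_funD[OF le, of i] by (simp add: beta_number_def of_nat_diff)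
  have prod: "(\<Prod>i<d. ?x ^ (lam i - rho i)) = monomial (replicate_mset (card (skew_diagram lam rho)) v)"
    by (simp add: monomial_replicate card_skew_diagram[OF len] power_sum)
  show ?thesis
  proof (cases is_odd)
    case True
    have minor_eq: "toeplitz_minor d (letters is_odd {v}) (beta_number lam) (beta_number rho) =
        (\<Prod>i<d. if lam i \<le> Suc (rho i) then ?x ^ (lam i - rho i) else 0)"
    proof (subst minor_01)
      show "(\<Prod>i<d. letters is_odd {v} (beta_number lam i - beta_number rho i)) =
          (\<Prod>i<d. if lam i \<le> Suc (rho i) then ?x ^ (lam i - rho i) else 0)"
      proof (rule prod.cong[OF refl])
        fix i
        have "lam i - rho i = 0 \<or> lam i - rho i = 1" if "lam i \<le> Suc (rho i)" using that by linarith
        then show "letters is_odd {v} (beta_number lam i - beta_number rho i) =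
            (if lam i \<le> Suc (rho i) then ?x ^ (lam i - rho i) else 0)"
          using True by (auto simp: diff super_complete_odd_letter)
      qed
    qed (use True lam rho beta_less in \<open>auto simp: super_complete_odd_letter\<close>)
    show ?thesis
    proof (cases "strip is_odd lam rho")
      case True
      then have "lam i \<le> Suc (rho i)" for i using \<open>is_odd\<close> by (simp add: strip_def)
      then show ?thesis using True by (simp add: minor_eq prod)
    next
      case False
      then obtain i where i: "\<not> lam i \<le> Suc (rho i)" using \<open>is_odd\<close> by (auto simp: strip_def)
      then have "i < d" using len[of i] by (cases "d \<le> i") auto
      then show ?thesis using False i by (auto simp: minor_eq intro!: prod_zero)
    qed
  next
    case even: False
    have minor_eq: "toeplitz_minor d (letters is_odd {v}) (beta_number lam) (beta_number rho) =
        (\<Prod>i<d. if beta_number rho i \<le> beta_number lam i \<and> (Suc i < d \<longrightarrow> beta_number lam (Suc i) < beta_number rho i)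
          then ?x ^ nat (beta_number lam i - beta_number rho i) else 0)"
      by (rule minor_geometric)
         (use even lam rho beta_less in \<open>auto simp: super_complete_even_letter\<close>)
    also have "\<dots> = (\<Prod>i<d. if lam (Suc i) \<le> rho i then ?x ^ (lam i - rho i) else 0)"
    proof (rule prod.cong[OF refl])
      fix i
      have "(Suc i < d \<longrightarrow> beta_number lam (Suc i) < beta_number rho i) \<longleftrightarrow> lam (Suc i) \<le> rho i"
        using len[of "Suc i"] by (cases "Suc i < d") (auto simp: beta_number_def)
      moreover have "beta_number rho i \<le> beta_number lam i" using diff[of i] by linarith
      ultimately show "(if beta_number rho i \<le> beta_number lam i \<and> (Suc i < d \<longrightarrow> beta_number lam (Suc i) < beta_number rho i)
          then ?x ^ nat (beta_number lam i - beta_number rho i) else 0) =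
          (if lam (Suc i) \<le> rho i then ?x ^ (lam i - rho i) else 0)"
        by (simp add: diff)
    qed
    finally have minor_eq: "toeplitz_minor d (letters is_odd {v}) (beta_number lam) (beta_number rho) =
        (\<Prod>i<d. if lam (Suc i) \<le> rho i then ?x ^ (lam i - rho i) else 0)" .
    show ?thesis
    proof (cases "strip is_odd lam rho")
      case True
      then have "lam (Suc i) \<le> rho i" for i using even by (simp add: strip_def)
      then show ?thesis using True by (simp add: minor_eq prod)
    next
      case False
      then obtain i where i: "\<not> lam (Suc i) \<le> rho i" using even by (auto simp: strip_def)
      then have "i < d" using len[of "Suc i"] by (cases "d \<le> Suc i") auto
      then show ?thesis using False i by (auto simp: minor_eq intro!: prod_zero)
    qed
  qed
qed

text \<open>
  Induction on the alphabet in the order given by \<open>f\<close>: tableaux lose their largest letter by the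
  branching rule, and minors lose the corresponding variable by \<open>minor_compose\<close>. Because the
  minor does not mention \<open>f\<close>, this also shows that the order of the letters is irrelevant.
\<close>

lemma sum_tableaux_minor:
  assumes "finite W" and "inj_on f W"
    and "is_partition lam" and "is_partition mu" and "mu \<le> lam"
    and "\<And>i. d \<le> i \<Longrightarrow> lam i = 0"
  shows "(\<Sum>T\<in>tableaux f is_odd W lam mu. monomial (tableau_content lam mu T)) =
    (toeplitz_minor d (letters is_odd W) (beta_number lam) (beta_number mu) :: ('v, 'c::comm_ring_1) mps)"
  using assms
proof (induction W arbitrary: lam rule: finite_ranking_induct[where f = f])
  case empty
  have "toeplitz_minor d (letters is_odd ({} :: 'v set)) (beta_number lam) (beta_number mu) =
      (\<Prod>i<d. letters is_odd {} (beta_number lam i - beta_number mu i) :: ('v, 'c) mps)"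
    by (rule minor_01) (use empty.prems beta_less in \<open>auto simp: super_complete_empty\<close>)
  also have "\<dots> = of_bool (\<forall>i<d. lam i = mu i)"
    by (auto simp: super_complete_empty beta_number_def intro!: prod.neutral prod_zero)
  also have "(\<forall>i<d. lam i = mu i) \<longleftrightarrow> lam = mu"
  proof
    assume "\<forall>i<d. lam i = mu i"
    then show "lam = mu"
      using empty.prems(5) le_funD[OF empty.prems(4)] by (metis ext le_zero_eq not_le)
  qed simp
  also have "of_bool (lam = mu) = (\<Sum>T\<in>tableaux f is_odd {} lam mu. monomial (tableau_content lam mu T) :: ('v, 'c) mps)"
  proof (cases "lam = mu")
    case True
    then have "skew_diagram lam mu = {}" by (auto simp: skew_diagram_def)
    then show ?thesis using True by (simp add: tableaux_def tableau_content_def)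
  next
    case False
    then obtain i where "lam i \<noteq> mu i" by auto
    then have "(i, mu i) \<in> skew_diagram lam mu"
      using le_funD[OF empty.prems(4), of i] by (simp add: in_skew_diagram)
    then have "tableaux f is_odd {} lam mu = {}" by (auto simp: tableaux_def)
    then show ?thesis using False by simp
  qed
  finally show ?case by simp
next
  case (insert v W)
  show ?case
  proof (cases "v \<in> W")
    case True
    then show ?thesis using insert by (simp add: insert_absorb)
  next
    case False
    have f: "f w < f v" if "w \<in> W" for w
      using insert.hyps(2)[OF that] insert.prems(1) that False
      by (auto simp: inj_on_def order_less_le)
    have le_len: "rho i = 0" if "rho \<le> lam" "d \<le> i" for rho i
      using le_funD[OF that(1), of i] insert.prems(5)[OF that(2)] by simp
    have "(\<Sum>T\<in>tableaux f is_odd (insert v W) lam mu. monomial (tableau_content lam mu T)) =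
      (\<Sum>rho | is_partition rho \<and> mu \<le> rho \<and> rho \<le> lam.
        if strip is_odd lam rho
        then \<Sum>T\<in>tableaux f is_odd W rho mu.
          monomial (tableau_content rho mu T + replicate_mset (card (skew_diagram lam rho)) v)
        else (0 :: ('v, 'c) mps))"
      by (rule sum_tableaux_peel) (use insert f in auto)
    also have "\<dots> = (\<Sum>rho | is_partition rho \<and> mu \<le> rho \<and> rho \<le> lam.
        toeplitz_minor d (letters is_odd {v}) (beta_number lam) (beta_number rho) * toeplitz_minor d (letters is_odd W) (beta_number rho) (beta_number mu))"
    proof (rule sum.cong[OF refl])
      fix rho assume rho: "rho \<in> {rho. is_partition rho \<and> mu \<le> rho \<and> rho \<le> lam}"
      have IH: "(\<Sum>T\<in>tableaux f is_odd W rho mu. monomial (tableau_content rho mu T)) =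
          (toeplitz_minor d (letters is_odd W) (beta_number rho) (beta_number mu) :: ('v, 'c) mps)"
        by (rule insert.IH) (use rho insert.prems le_len in auto)
      have "toeplitz_minor d (letters is_odd {v}) (beta_number lam) (beta_number rho) =
          (if strip is_odd lam rho then monomial (replicate_mset (card (skew_diagram lam rho)) v)
           else 0 :: ('v, 'c) mps)"
        by (rule minor_letter) (use rho insert.prems in auto)
      then show "(if strip is_odd lam rho
          then \<Sum>T\<in>tableaux f is_odd W rho mu.
            monomial (tableau_content rho mu T + replicate_mset (card (skew_diagram lam rho)) v)
          else 0) = toeplitz_minor d (letters is_odd {v}) (beta_number lam) (beta_number rho) *
            (toeplitz_minor d (letters is_odd W) (beta_number rho) (beta_number mu) :: ('v, 'c) mps)"
        by (simp add: monomial_add mult.commute flip: IH sum_distrib_right)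
    qed
    also have "\<dots> = toeplitz_minor d (super_complete
        ((if is_odd then {} else {v}) \<union> (if is_odd then {} else W))
        ((if is_odd then {v} else {}) \<union> (if is_odd then W else {}))) (beta_number lam) (beta_number mu)"
      by (rule minor_compose) (use insert.prems False in auto)
    also have "\<dots> = toeplitz_minor d (letters is_odd (insert v W)) (beta_number lam) (beta_number mu)"
      by (cases is_odd) simp_all
    finally show ?thesis .
  qed
qed

text \<open>
  Only the letters of \<open>m\<close> matter for the coefficient at \<open>m\<close>, on both sides, so the finite case
  applies to the restricted alphabet.
\<close>

lemma minor_letters_coeff:
  fixes m :: "'v multiset"
  assumes f: "inj_on f V" and lam: "is_partition lam" and mu: "is_partition mu" "mu \<le> lam"
    and len: "\<And>i. d \<le> i \<Longrightarrow> lam i = 0"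
  shows "mps_coeff (toeplitz_minor d (letters is_odd V) (beta_number lam) (beta_number mu)) m =
    (of_nat (card {T \<in> tableaux f is_odd V lam mu. tableau_content lam mu T = m}) :: 'c::comm_ring_1)"
proof -
  let ?W = "V \<inter> set_mset m"
  have W: "finite ?W" "inj_on f ?W" using f by (auto intro: inj_on_subset)
  have restrict: "agree m (letters is_odd V k :: ('v, 'c) mps) (letters is_odd ?W k)" for k
    using agree_super_complete[of m "if is_odd then {} else V" "if is_odd then V else {}" k]
    by (cases is_odd) simp_all
  have "mps_coeff (toeplitz_minor d (letters is_odd V) (beta_number lam) (beta_number mu)) m =
      (mps_coeff (toeplitz_minor d (letters is_odd ?W) (beta_number lam) (beta_number mu)) m :: 'c)"
    by (intro agreeD agree_minor restrict)
  also have "\<dots> = (\<Sum>T\<in>tableaux f is_odd ?W lam mu. of_bool (m = tableau_content lam mu T))"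
    by (simp add: sum_tableaux_minor[OF W lam mu len, symmetric] mps_coeff_sum monomial_def)
  also have "\<dots> = of_nat (card {T \<in> tableaux f is_odd ?W lam mu. tableau_content lam mu T = m})"
    using finite_tableaux[OF lam W(1)] by (simp add: Int_def eq_commute conj_commute)
  also have "{T \<in> tableaux f is_odd ?W lam mu. tableau_content lam mu T = m} =
      {T \<in> tableaux f is_odd V lam mu. tableau_content lam mu T = m}"
  proof -
    have "T \<in> skew_diagram lam mu \<rightarrow>\<^sub>E ?W \<longleftrightarrow> T \<in> skew_diagram lam mu \<rightarrow>\<^sub>E V"
      if "tableau_content lam mu T = m" for T
    proof -
      have "set_mset m = T ` skew_diagram lam mu"
        using finite_skew_diagram[OF lam] that by (auto simp: tableau_content_def)
      then show ?thesis by (auto simp: PiE_iff)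
    qed
    then show ?thesis unfolding tableaux_def by blast
  qed
  finally show ?thesis .
qed

lemma ssyts_eq_tableaux:
  assumes "countable V"
  shows "ssyts V lam mu = tableaux (to_nat_on V) False V lam mu"
proof -
  have "to_nat_on V x \<le> to_nat_on V y \<longleftrightarrow> to_nat_on V x < to_nat_on V y \<or> x = y"
    if "x \<in> V" "y \<in> V" for x y
    using inj_on_to_nat_on[OF assms] that by (auto simp: inj_on_def order_le_less)
  then show ?thesis unfolding ssyts_def tableaux_def
    by (intro Collect_cong conj_cong refl) (auto simp: PiE_iff)
qed

lemma skew_schur_minor:
  assumes V: "countable V" and lam: "is_partition lam" and mu: "is_partition mu" "mu \<le> lam"
    and len: "\<And>i. d \<le> i \<Longrightarrow> lam i = 0"
  shows "skew_schur V lam mu = (toeplitz_minor d (super_complete V {}) (beta_number lam) (beta_number mu) :: ('v, 'c::comm_ring_1) mps)"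
  by (rule mps_eqI)
     (simp add: skew_schur_def ssyts_eq_tableaux[OF V] tableau_content_def[symmetric]
       minor_letters_coeff[where is_odd = False, OF inj_on_to_nat_on[OF V] lam mu len, simplified if_False])

lemma less_conj_part:
  assumes p: "is_partition p"
  shows "i < conj_part p j \<longleftrightarrow> j < p i"
proof -
  have down: "j < p k" if "j < p i" "k \<le> i" for i k
    using p that antimonoD[of p k i] by (auto simp: is_partition_def)
  show ?thesis
  proof
    assume "j < p i"
    then have "{..i} \<subseteq> {i. j < p i}" using down by auto
    from card_mono[OF finite_above[OF p] this] show "i < conj_part p j" by (simp add: conj_part_def)
  next
    assume lt: "i < conj_part p j"
    show "j < p i"
    proof (rule ccontr)
      assume "\<not> j < p i"
      then have "{i. j < p i} \<subseteq> {..<i}" using down by (auto simp: not_le[symmetric])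
      from card_mono[OF _ this] show False using lt by (simp add: conj_part_def)
    qed
  qed
qed

lemma in_skew_diagram_conj_part:
  assumes "is_partition lam" "is_partition nu"
  shows "(j, i) \<in> skew_diagram (conj_part lam) (conj_part nu) \<longleftrightarrow> (i, j) \<in> skew_diagram lam nu"
proof -
  have "conj_part nu j \<le> i \<longleftrightarrow> nu i \<le> j" using less_conj_part[OF assms(2), of i j] by linarith
  then show ?thesis by (simp add: in_skew_diagram less_conj_part[OF assms(1)])
qed

lemma restrict_swap_swap:
  assumes T: "T \<in> B \<rightarrow>\<^sub>E X" and "prod.swap ` B \<subseteq> A"
  shows "restrict (restrict (T \<circ> prod.swap) A \<circ> prod.swap) B = T"
proof
  fix c
  show "restrict (restrict (T \<circ> prod.swap) A \<circ> prod.swap) B c = T c"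
    using assms(2) PiE_arb[OF T, of c] by (cases "c \<in> B") auto
qed

text \<open>
  Transposing the cells turns a semistandard tableau of the conjugate shape into a filling of the
  original shape by odd letters.
\<close>

lemma skew_schur_conj_part_minor:
  assumes V: "countable V" and lam: "is_partition lam" and nu: "is_partition nu" "nu \<le> lam"
    and len: "\<And>i. d \<le> i \<Longrightarrow> lam i = 0"
  shows "skew_schur V (conj_part lam) (conj_part nu) =
    (toeplitz_minor d (super_complete {} V) (beta_number lam) (beta_number nu) :: ('v, 'c::comm_ring_1) mps)"
proof (rule mps_eqI)
  fix m :: "'v multiset"
  let ?L = "skew_diagram lam nu" and ?C = "skew_diagram (conj_part lam) (conj_part nu)"
  let ?f = "to_nat_on V"
  note sd = in_skew_diagram_conj_part[OF lam nu(1)]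
  have C: "?C = prod.swap ` ?L"
  proof (intro equalityI subsetI)
    fix c assume "c \<in> ?C"
    then have "prod.swap c \<in> ?L" using sd by (cases c) auto
    then show "c \<in> prod.swap ` ?L" by (intro image_eqI[of _ _ "prod.swap c"]) auto
  qed (use sd in auto)
  have C_L: "prod.swap ` ?C \<subseteq> ?L" "prod.swap ` ?L \<subseteq> ?C" by (auto simp: C)
  have "bij_betw (\<lambda>T. restrict (T \<circ> prod.swap) ?L)
      {T \<in> ssyts V (conj_part lam) (conj_part nu). image_mset T (mset_set ?C) = m}
      {T \<in> tableaux ?f True V lam nu. tableau_content lam nu T = m}"
  proof (rule bij_betw_byWitness[where f' = "\<lambda>T. restrict (T \<circ> prod.swap) ?C"])
    have content_swap: "image_mset (restrict (T \<circ> prod.swap) ?L) (mset_set ?L) = image_mset T (mset_set ?C)" for T :: "nat \<times> nat \<Rightarrow> 'v"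
    proof -
      have "image_mset (restrict (T \<circ> prod.swap) ?L) (mset_set ?L) = image_mset (T \<circ> prod.swap) (mset_set ?L)"
        using finite_skew_diagram[OF lam] by (intro image_mset_cong) auto
      also have "\<dots> = image_mset T (image_mset prod.swap (mset_set ?L))"
        by (simp add: multiset.map_comp)
      also have "image_mset prod.swap (mset_set ?L) = mset_set ?C"
        unfolding C by (intro image_mset_mset_set) (auto simp: inj_on_def)
      finally show ?thesis .
    qed
    have eq: "?f x \<le> ?f y \<longleftrightarrow> ?f x < ?f y \<or> x = y" if "x \<in> V" "y \<in> V" for x y
      using inj_on_to_nat_on[OF V] that by (auto simp: inj_on_def order_le_less)
    show "\<forall>T\<in>{T \<in> ssyts V (conj_part lam) (conj_part nu). image_mset T (mset_set ?C) = m}.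
        restrict (restrict (T \<circ> prod.swap) ?L \<circ> prod.swap) ?C = T"
      using restrict_swap_swap[OF _ C_L(1)] by (auto simp: ssyts_def)
    show "\<forall>T\<in>{T \<in> tableaux ?f True V lam nu. tableau_content lam nu T = m}.
        restrict (restrict (T \<circ> prod.swap) ?C \<circ> prod.swap) ?L = T"
      using restrict_swap_swap[OF _ C_L(2)] by (auto simp: tableaux_def)
    show "(\<lambda>T. restrict (T \<circ> prod.swap) ?L) `
        {T \<in> ssyts V (conj_part lam) (conj_part nu). image_mset T (mset_set ?C) = m}
        \<subseteq> {T \<in> tableaux ?f True V lam nu. tableau_content lam nu T = m}"
    proof clarify
      fix T assume T: "T \<in> ssyts V (conj_part lam) (conj_part nu)" and m: "m = image_mset T (mset_set ?C)"
      then have TV: "T (j, i) \<in> V" if "(i, j) \<in> ?L" for i j using that sd by (auto simp: ssyts_def)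
      have "?f (T (j, i)) \<le> ?f (T (j, i'))" if "(i, j) \<in> ?L" "(i', j) \<in> ?L" "i < i'" for i i' j
        using T that sd unfolding ssyts_def by blast
      moreover have "?f (T (j, i)) < ?f (T (j', i))" if "(i, j) \<in> ?L" "(i, j') \<in> ?L" "j < j'" for i j j'
        using T that sd unfolding ssyts_def by blast
      ultimately show "restrict (T \<circ> prod.swap) ?L \<in> tableaux ?f True V lam nu \<and>
          tableau_content lam nu (restrict (T \<circ> prod.swap) ?L) = image_mset T (mset_set ?C)"
        using content_swap TV eq by (auto simp: tableaux_def tableau_content_def)
    qed
    show "(\<lambda>T. restrict (T \<circ> prod.swap) ?C) ` {T \<in> tableaux ?f True V lam nu. tableau_content lam nu T = m}
        \<subseteq> {T \<in> ssyts V (conj_part lam) (conj_part nu). image_mset T (mset_set ?C) = m}"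
    proof clarify
      fix T assume T: "T \<in> tableaux ?f True V lam nu" and m: "m = tableau_content lam nu T"
      then have TV: "T (i, j) \<in> V" if "(i, j) \<in> ?L" for i j using that by (auto simp: tableaux_def)
      have "?f (T (i, j)) < ?f (T (i', j)) \<or> T (i, j) = T (i', j)"
        if "(i, j) \<in> ?L" "(i', j) \<in> ?L" "i < i'" for i i' j
        using T that unfolding tableaux_def by blast
      then have "?f (T (i, j)) \<le> ?f (T (i', j))"
        if "(i, j) \<in> ?L" "(i', j) \<in> ?L" "i < i'" for i i' j
        using that TV eq by blast
      moreover have "?f (T (i, j)) < ?f (T (i, j'))" if "(i, j) \<in> ?L" "(i, j') \<in> ?L" "j < j'" for i j j'
        using T that unfolding tableaux_def by blast
      moreover have "restrict (restrict (T \<circ> prod.swap) ?C \<circ> prod.swap) ?L = T"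
        using T by (intro restrict_swap_swap[OF _ C_L(2)]) (auto simp: tableaux_def)
      then have "image_mset (restrict (T \<circ> prod.swap) ?C) (mset_set ?C) = tableau_content lam nu T"
        using content_swap[of "restrict (T \<circ> prod.swap) ?C"] by (simp add: tableau_content_def)
      ultimately show "restrict (T \<circ> prod.swap) ?C \<in> ssyts V (conj_part lam) (conj_part nu) \<and>
          image_mset (restrict (T \<circ> prod.swap) ?C) (mset_set ?C) = tableau_content lam nu T"
        using TV by (auto simp: ssyts_def sd)
    qed
  qed
  from bij_betw_same_card[OF this]
  show "mps_coeff (skew_schur V (conj_part lam) (conj_part nu)) m =
      mps_coeff (toeplitz_minor d (super_complete {} V) (beta_number lam) (beta_number nu) :: ('v, 'c) mps) m"
    by (simp add: skew_schur_def
        minor_letters_coeff[where is_odd = True, OF inj_on_to_nat_on[OF V] lam nu len, simplified if_True])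
qed

text \<open>
  The defining sum over the intermediate shape is the composition of the minors of the odd and of the
  even letters.
\<close>

theorem super_jacobi_trudi:
  assumes V: "countable V0" "countable V1" "V0 \<inter> V1 = {}"
    and lam: "is_partition lam" and mu: "is_partition mu" "mu \<le> lam"
    and len: "\<And>i. d \<le> i \<Longrightarrow> lam i = 0"
  shows "super_schur V0 V1 lam mu =
    (toeplitz_minor d (super_complete V0 V1) (beta_number lam) (beta_number mu) :: ('v, 'c::comm_ring_1) mps)"
proof -
  have "super_schur V0 V1 lam mu = (\<Sum>nu | is_partition nu \<and> mu \<le> nu \<and> nu \<le> lam.
      toeplitz_minor d (super_complete {} V1) (beta_number lam) (beta_number nu) *
      toeplitz_minor d (super_complete V0 {}) (beta_number nu) (beta_number mu) :: ('v, 'c) mps)"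
    unfolding super_schur_def
  proof (rule sum.cong[OF refl])
    fix nu assume "nu \<in> {nu. is_partition nu \<and> mu \<le> nu \<and> nu \<le> lam}"
    then have nu: "is_partition nu" "mu \<le> nu" "nu \<le> lam" by auto
    have len': "nu i = 0" if "d \<le> i" for i using len[OF that] le_funD[OF nu(3), of i] by simp
    show "skew_schur V0 nu mu * skew_schur V1 (conj_part lam) (conj_part nu) =
        toeplitz_minor d (super_complete {} V1) (beta_number lam) (beta_number nu) *
        (toeplitz_minor d (super_complete V0 {}) (beta_number nu) (beta_number mu) :: ('v, 'c) mps)"
      by (simp add: skew_schur_minor[OF V(1) nu(1) mu(1) nu(2) len']
          skew_schur_conj_part_minor[OF V(2) lam nu(1,3) len] mult.commute)
  qed
  also have "\<dots> = toeplitz_minor d (super_complete ({} \<union> V0) (V1 \<union> {})) (beta_number lam) (beta_number mu)"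
    by (rule minor_compose) (use V lam mu len in auto)
  finally show ?thesis by simp
qed

section \<open>The two-sided generating function\<close>

text \<open>
  For disjoint \<open>V0\<close> and \<open>V1\<close>, the expansion of the product of \<open>1 + c v * x\<^sub>v\<close> over \<open>V1\<close> divided by the product of
  \<open>1 - c v * x\<^sub>v\<close> over \<open>V0\<close>.
\<close>

definition weighted_admissible ::
  "('v \<Rightarrow> 'c) \<Rightarrow> 'v set \<Rightarrow> 'v set \<Rightarrow> ('v, 'c::comm_ring_1) mps" where
  "weighted_admissible c V0 V1 = Abs_mps (\<lambda>m. if admissible V0 V1 m then prod_mset (image_mset c m) else 0)"

lemma weighted_admissible_insert_even:
  fixes c :: "'v \<Rightarrow> 'c::comm_ring_1"
  assumes "v \<notin> V0 \<union> V1"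
  shows "weighted_admissible c (insert v V0) V1 * (1 - mps_term (c v) v) = weighted_admissible c V0 V1"
proof (rule mps_eqI)
  fix m :: "'v multiset"
  let ?G = "weighted_admissible c (insert v V0) V1"
  have "mps_coeff (?G * (1 - mps_term (c v) v)) m = mps_coeff ?G m - mps_coeff (mps_term (c v) v * ?G) m"
    by (simp add: algebra_simps)
  also have "\<dots> = mps_coeff (weighted_admissible c V0 V1) m"
  proof (cases "v \<in># m")
    case True
    then obtain n where m: "m = add_mset v n" by (metis mset_add)
    have "admissible (insert v V0) V1 m \<longleftrightarrow> admissible (insert v V0) V1 n" "\<not> admissible V0 V1 m"
      using assms by (auto simp: m admissible_def)
    then show ?thesis by (simp add: weighted_admissible_def mps_coeff_term_mult m)
  next
    case False
    then have "admissible (insert v V0) V1 m \<longleftrightarrow> admissible V0 V1 m"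
      by (auto simp: admissible_def)
    then show ?thesis using False by (simp add: weighted_admissible_def mps_coeff_term_mult)
  qed
  finally show "mps_coeff (?G * (1 - mps_term (c v) v)) m = mps_coeff (weighted_admissible c V0 V1) m" .
qed

lemma weighted_admissible_insert_odd:
  fixes c :: "'v \<Rightarrow> 'c::comm_ring_1"
  assumes "v \<notin> V0 \<union> V1"
  shows "weighted_admissible c V0 (insert v V1) = weighted_admissible c V0 V1 * (1 + mps_term (c v) v)"
proof (rule mps_eqI)
  fix m :: "'v multiset"
  let ?G = "weighted_admissible c V0 V1"
  have "mps_coeff (?G * (1 + mps_term (c v) v)) m = mps_coeff ?G m + mps_coeff (mps_term (c v) v * ?G) m"
    by (simp add: algebra_simps)
  also have "\<dots> = mps_coeff (weighted_admissible c V0 (insert v V1)) m"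
  proof (cases "v \<in># m")
    case True
    then obtain n where m: "m = add_mset v n" by (metis mset_add)
    have "admissible V0 (insert v V1) m \<longleftrightarrow> admissible V0 V1 n" "\<not> admissible V0 V1 m"
      using assms by (auto simp: m admissible_def count_eq_zero_iff)
    then show ?thesis by (simp add: weighted_admissible_def mps_coeff_term_mult m)
  next
    case False
    then have "count m v = 0" by (simp add: count_eq_zero_iff)
    with False have "admissible V0 (insert v V1) m \<longleftrightarrow> admissible V0 V1 m"
      by (auto simp: admissible_def)
    then show ?thesis using False by (simp add: weighted_admissible_def mps_coeff_term_mult)
  qed
  finally show "mps_coeff (weighted_admissible c V0 (insert v V1)) m = mps_coeff (?G * (1 + mps_term (c v) v)) m" ..
qed

lemma weighted_admissible_finite:
  assumes "finite V0" "finite V1" "V0 \<inter> V1 = {}"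
  shows "weighted_admissible c V0 V1 * (\<Prod>v\<in>V0. 1 - mps_term (c v) v) = (\<Prod>v\<in>V1. 1 + mps_term (c v) v)"
  using assms
proof (induction V0 rule: finite_induct)
  case empty
  from empty(1) show ?case
  proof (induction V1 rule: finite_induct)
    case empty
    show ?case by (rule mps_eqI) (auto simp: weighted_admissible_def admissible_def)
  next
    case (insert v V1)
    then show ?case by (simp add: weighted_admissible_insert_odd mult.commute)
  qed
next
  case (insert v V0)
  then have "weighted_admissible c (insert v V0) V1 * (1 - mps_term (c v) v) = weighted_admissible c V0 V1"
    by (intro weighted_admissible_insert_even) auto
  then show ?case using insert by (simp add: mult.assoc[symmetric])
qed

lemma agree_weighted_admissible:
  "agree m (weighted_admissible c V0 V1) (weighted_admissible c (V0 \<inter> set_mset m) (V1 \<inter> set_mset m))"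
  by (simp add: agree_def weighted_admissible_def admissible_restrict[of _ m V0 V1])

text \<open>
  The factors of variables that do not divide \<open>m\<close> agree with \<open>1\<close>.
\<close>

lemma agree_prodinf:
  fixes c :: "'i \<Rightarrow> 'c::comm_ring_1"
  assumes inj: "inj_on v I"
  shows "agree m (mps_prodinf (\<lambda>i. 1 + mps_term (c i) (v i)) I)
    (\<Prod>i | i \<in> I \<and> v i \<in># m. 1 + mps_term (c i) (v i))"
  unfolding agree_def
proof (intro allI impI)
  fix k assume k: "k \<subseteq># m"
  let ?J = "{i \<in> I. v i \<in># m}"
  have fin: "finite ?J"
    by (rule inj_on_finite[of v _ "set_mset m"]) (use inj in \<open>auto simp: inj_on_def\<close>)
  have "agree k (1 + mps_term (c i) (v i)) (if v i \<in># k then 1 + mps_term (c i) (v i) else 1)" for i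
  proof -
    have "n \<noteq> {#v i#}" if "n \<subseteq># k" "v i \<notin># k" for n
      using that by auto
    then show ?thesis by (auto simp: agree_def mps_term_def)
  qed
  then have "agree k (\<Prod>i\<in>?J. 1 + mps_term (c i) (v i))
      (\<Prod>i\<in>?J. if v i \<in># k then 1 + mps_term (c i) (v i) else 1)"
    by (intro agree_prod)
  also have "(\<Prod>i\<in>?J. if v i \<in># k then 1 + mps_term (c i) (v i) else 1) =
      (\<Prod>i | i \<in> I \<and> v i \<in># k. 1 + mps_term (c i) (v i))"
    using fin mset_subset_eqD[OF k]
    by (subst prod.inter_filter[symmetric]) (auto intro!: prod.cong)
  finally show "mps_coeff (mps_prodinf (\<lambda>i. 1 + mps_term (c i) (v i)) I) k =
      mps_coeff (\<Prod>i\<in>?J. 1 + mps_term (c i) (v i)) k"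
    by (simp add: mps_coeff_prodinf[OF inj] agreeD)
qed

text \<open>
  The power of \<open>t\<close> that accompanies each variable in the generating function.
\<close>

definition hAB_weight :: "'a + 'b \<Rightarrow> 'c::comm_ring_1 fls" where
  "hAB_weight = case_sum (\<lambda>_. fls_X) (\<lambda>_. fls_X_inv)"

lemma mps_term_minus: "mps_term (- c) v = - mps_term c v"
  by (rule mps_eqI) (simp add: mps_term_def)

text \<open>
  One product over the variables from both alphabets; the sign \<open>e\<close> covers numerator and denominator.
\<close>

lemma agree_prodinf_sum:
  fixes e :: "'c::comm_ring_1 fls" and m :: "('a + 'b) multiset"
  shows "agree m
    (mps_prodinf (\<lambda>a. 1 + mps_term (e * hAB_weight (Inl a :: 'a + 'b)) (Inl a)) A *
     mps_prodinf (\<lambda>b. 1 + mps_term (e * hAB_weight (Inr b :: 'a + 'b)) (Inr b)) B)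
    (\<Prod>v\<in>(Inl ` A \<union> Inr ` B) \<inter> set_mset m. 1 + mps_term (e * hAB_weight v) v)"
proof -
  let ?A = "{a \<in> A. (Inl a :: 'a + 'b) \<in># m}" and ?B = "{b \<in> B. (Inr b :: 'a + 'b) \<in># m}"
  let ?F = "\<lambda>v. 1 + mps_term (e * hAB_weight v) v"
  have set: "(Inl ` A \<union> Inr ` B) \<inter> set_mset m = Inl ` ?A \<union> Inr ` ?B" by auto
  have fin: "finite (Inl ` ?A :: ('a + 'b) set)" "finite (Inr ` ?B :: ('a + 'b) set)"
    by (rule finite_subset[OF _ finite_set_mset[of m]]; auto)+
  have "(\<Prod>v\<in>(Inl ` A \<union> Inr ` B) \<inter> set_mset m. ?F v) = (\<Prod>v\<in>Inl ` ?A. ?F v) * (\<Prod>v\<in>Inr ` ?B. ?F v)"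
    unfolding set using fin by (intro prod.union_disjoint) auto
  also have "\<dots> = (\<Prod>a\<in>?A. ?F (Inl a)) * (\<Prod>b\<in>?B. ?F (Inr b))"
    by (simp add: prod.reindex)
  finally show ?thesis
    by (auto intro!: agree_mult agree_prodinf)
qed

text \<open>
  The expanded series solves the equation that characterises the generating function, and the
  denominator can be cancelled because its constant term is \<open>1\<close>.
\<close>

lemma hAB_gf_weighted_admissible:
  fixes A0 A1 :: "'a set" and B0 B1 :: "'b set"
  assumes disj: "A0 \<inter> A1 = {}" "B0 \<inter> B1 = {}"
  shows "hAB_gf A0 A1 B0 B1 = (weighted_admissible hAB_weight (Inl ` A0 \<union> Inr ` B0) (Inl ` A1 \<union> Inr ` B1)
    :: ('a + 'b, 'c::comm_ring_1 fls) mps)"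
proof -
  let ?V0 = "Inl ` A0 \<union> Inr ` B0 :: ('a + 'b) set" and ?V1 = "Inl ` A1 \<union> Inr ` B1 :: ('a + 'b) set"
  let ?w = "hAB_weight :: 'a + 'b \<Rightarrow> 'c fls"
  let ?G = "weighted_admissible ?w ?V0 ?V1"
  have eq: "?G * hAB_denom A0 B0 = hAB_numer A1 B1"
  proof (rule mps_eqI)
    fix m :: "('a + 'b) multiset"
    let ?W0 = "?V0 \<inter> set_mset m" and ?W1 = "?V1 \<inter> set_mset m"
    have "agree m (hAB_denom A0 B0) (\<Prod>v\<in>?W0. 1 - mps_term (?w v) v)"
      using agree_prodinf_sum[of m "- 1 :: 'c fls" A0 B0]
      by (simp add: hAB_denom_def mps_term_minus hAB_weight_def)
    then have "agree m (?G * hAB_denom A0 B0)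
        (weighted_admissible ?w ?W0 ?W1 * (\<Prod>v\<in>?W0. 1 - mps_term (?w v) v))"
      by (intro agree_mult agree_weighted_admissible)
    also have "\<dots> = (\<Prod>v\<in>?W1. 1 + mps_term (?w v) v)"
      using disj by (intro weighted_admissible_finite) auto
    finally have "mps_coeff (?G * hAB_denom A0 B0) m = mps_coeff (\<Prod>v\<in>?W1. 1 + mps_term (?w v) v) m"
      by (rule agreeD)
    also have "agree m (hAB_numer A1 B1) (\<Prod>v\<in>?W1. 1 + mps_term (?w v) v)"
      using agree_prodinf_sum[of m "1 :: 'c fls" A1 B1] by (simp add: hAB_numer_def hAB_weight_def)
    then have "mps_coeff (\<Prod>v\<in>?W1. 1 + mps_term (?w v) v) m = mps_coeff (hAB_numer A1 B1) m"
      by (simp add: agreeD)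
    finally show "mps_coeff (?G * hAB_denom A0 B0) m = mps_coeff (hAB_numer A1 B1) m" .
  qed
  obtain g :: "('a + 'b, 'c fls) mps" where g: "g * hAB_denom A0 B0 = 1"
    using mps_invertible[OF hAB_denom_const] by blast
  have cancel: "G = G * hAB_denom A0 B0 * g" for G :: "('a + 'b, 'c fls) mps"
  proof -
    have "G * hAB_denom A0 B0 * g = G * (g * hAB_denom A0 B0)" by (simp only: ac_simps)
    then show ?thesis by (simp add: g)
  qed
  have "hAB_gf A0 A1 B0 B1 = hAB_gf A0 A1 B0 B1 * hAB_denom A0 B0 * g" by (rule cancel)
  also have "\<dots> = ?G * hAB_denom A0 B0 * g" by (simp only: hAB_gf_eq eq)
  also have "\<dots> = ?G" by (rule cancel[symmetric])
  finally show ?thesis .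
qed

lemma prod_hAB_weight:
  fixes m :: "('a + 'b) multiset"
  shows "prod_mset (image_mset hAB_weight m) =
    (fls_X_intpow (int (size {#v \<in># m. isl v#}) - int (size {#v \<in># m. \<not> isl v#})) :: 'c::comm_ring_1 fls)"
proof (induction m)
  case (add v m)
  let ?e = "if isl v then 1 else - 1"
  let ?s = "\<lambda>m :: ('a + 'b) multiset. int (size {#v \<in># m. isl v#}) - int (size {#v \<in># m. \<not> isl v#})"
  have "hAB_weight v = (fls_X_intpow ?e :: 'c fls)"
    by (cases v) (simp_all add: hAB_weight_def fls_X_conv_shift_1 fls_X_inv_conv_shift_1)
  then have "prod_mset (image_mset hAB_weight (add_mset v m)) = (fls_X_intpow ?e * fls_X_intpow (?s m) :: 'c fls)"
    using add by simp
  also have "\<dots> = fls_X_intpow (?e + ?s m)" by (rule fls_X_intpow_times_fls_X_intpow)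
  also have "?e + ?s m = ?s (add_mset v m)" by simp
  finally show ?case .
qed simp

text \<open>
  The power of \<open>t\<close> at a monomial is the number of its variables \<open>x\<^sub>a\<close> minus the number of its inverse
  variables.
\<close>

lemma hAB_eq:
  fixes A0 A1 :: "'a set" and B0 B1 :: "'b set"
  assumes "A0 \<inter> A1 = {}" "B0 \<inter> B1 = {}"
  shows "hAB A0 A1 B0 B1 k = (Abs_mps (\<lambda>m. of_bool
    (admissible (Inl ` A0 \<union> Inr ` B0) (Inl ` A1 \<union> Inr ` B1) m \<and>
      int (size {#v \<in># m. isl v#}) - int (size {#v \<in># m. \<not> isl v#}) = k))
    :: ('a + 'b, 'c::comm_ring_1) mps)"
  by (rule mps_eqI)
     (auto simp: hAB_def hAB_gf_weighted_admissible[OF assms] weighted_admissible_def prod_hAB_weight)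

section \<open>The determinant formula\<close>

text \<open>
  The sequence \<open>hAB\<close> is the convolution of the complete functions of the two alphabets, the second one
  reversed. The sum is infinite, but \<open>a - k\<close> is the degree in the first alphabet and does not
  exceed \<open>size m\<close> at a divisor of \<open>m\<close>.
\<close>

lemma agree_hAB_convolution:
  fixes A0 A1 :: "'a set" and B0 B1 :: "'b set" and m :: "('a + 'b) multiset"
  assumes "A0 \<inter> A1 = {}" "B0 \<inter> B1 = {}" and K: "finite K" "{a - int (size m)..a} \<subseteq> K"
  shows "agree m
    (\<Sum>k\<in>K. super_complete (Inl ` A0) (Inl ` A1) (a - k) * super_complete (Inr ` B0) (Inr ` B1) (b - k))
    (hAB A0 A1 B0 B1 (a - b) :: ('a + 'b, 'c::comm_ring_1) mps)"
  unfolding agree_def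
proof (intro allI impI)
  fix n assume n: "n \<subseteq># m"
  let ?Q = "admissible (Inl ` A0 \<union> Inr ` B0) (Inl ` A1 \<union> Inr ` B1) n"
  let ?s = "int (size {#v \<in># n. v \<in> Inl ` A0 \<union> Inl ` A1#})"
  let ?t = "int (size {#v \<in># n. v \<notin> Inl ` A0 \<union> Inl ` A1#})"
  have disj: "(Inl ` A0 \<union> Inl ` A1) \<inter> (Inr ` B0 \<union> Inr ` B1) = {}" by auto
  have "?s \<le> int (size n)" by (simp add: size_filter_mset_lesseq)
  also have "\<dots> \<le> int (size m)" using n by (simp add: size_mset_mono)
  finally have in_K: "a - ?s \<in> K" by (intro subsetD[OF K(2)]) simp
  have isl: "{#v \<in># n. isl v#} = {#v \<in># n. v \<in> Inl ` A0 \<union> Inl ` A1#}"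
    "{#v \<in># n. \<not> isl v#} = {#v \<in># n. v \<notin> Inl ` A0 \<union> Inl ` A1#}" if ?Q
    using that by (auto simp: admissible_def intro!: filter_mset_cong)
  have "mps_coeff (\<Sum>k\<in>K. super_complete (Inl ` A0) (Inl ` A1) (a - k) * super_complete (Inr ` B0) (Inr ` B1) (b - k)) n
      = (\<Sum>k\<in>K. of_bool (?Q \<and> ?s = a - k \<and> ?t = b - k) :: 'c)"
    by (simp only: mps_coeff_sum super_complete_mult_coeff[OF disj])
  also have "\<dots> = (\<Sum>k\<in>K. if k = a - ?s then of_bool (?Q \<and> ?t = b - (a - ?s)) else 0)"
    by (rule sum.cong) auto
  also have "\<dots> = of_bool (?Q \<and> ?t = b - (a - ?s))"
    using K(1) in_K by (simp only: sum.delta if_True)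
  also have "\<dots> = mps_coeff (hAB A0 A1 B0 B1 (a - b)) n"
    using isl by (auto simp: hAB_eq[OF assms(1,2)])
  finally show "mps_coeff (\<Sum>k\<in>K. super_complete (Inl ` A0) (Inl ` A1) (a - k) *
      super_complete (Inr ` B0) (Inr ` B1) (b - k)) n = (mps_coeff (hAB A0 A1 B0 B1 (a - b)) n :: 'c)" .
qed

lemma dominant_nth: "xs \<in> dominant d \<Longrightarrow> i \<le> j \<Longrightarrow> j < d \<Longrightarrow> xs ! j \<le> xs ! i"
  by (cases "i = j") (auto simp: dominant_def sorted_wrt_iff_nth_less)

lemma is_partition_shift_part:
  assumes "xs \<in> dominant d"
  shows "is_partition (shift_part p xs)"
proof -
  have "antimono (shift_part p xs)"
    using assms dominant_nth[OF assms]
    by (auto simp: antimono_def shift_part_def dominant_def intro!: nat_mono)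
  moreover have "{i. shift_part p xs i \<noteq> 0} \<subseteq> {..<length xs}" by (auto simp: shift_part_def)
  ultimately show ?thesis by (auto simp: is_partition_def intro: finite_subset)
qed

text \<open>
  The shift by \<open>p\<close>, needed to have partitions, cancels in the differences of indices. The rows of the
  rectangle become \<open>0, -1, -2, \<dots>\<close>.
\<close>

lemma SAB_term_minors:
  fixes A0 A1 :: "'a set" and B0 B1 :: "'b set"
  assumes A: "countable A0" "countable A1" "A0 \<inter> A1 = {}"
    and B: "countable B0" "countable B1" "B0 \<inter> B1 = {}"
    and d: "d \<ge> 1" and lam: "lam \<in> dominant d" and kappa: "kappa \<in> SAB_index lam"
  shows "SAB_term A0 A1 B0 B1 lam kappa =
    (toeplitz_minor d (super_complete (Inl ` A0) (Inl ` A1)) (\<lambda>i. lam ! i - int i) (\<lambda>i. kappa ! i - int i) *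
     toeplitz_minor d (super_complete (Inr ` B0) (Inr ` B1)) (\<lambda>i. - int i) (\<lambda>i. kappa ! i - int i)
     :: ('a + 'b, 'c::comm_ring_1) mps)"
proof -
  define p where "p = nat (- last kappa)"
  have len: "length lam = d" "length kappa = d" and kap: "kappa \<in> dominant d"
    and le: "\<And>i. i < d \<Longrightarrow> kappa ! i \<le> lam ! i" "\<And>i. i < d \<Longrightarrow> kappa ! i \<le> 0"
    using lam kappa by (auto simp: SAB_index_def dominant_def)
  have last: "last kappa = kappa ! (d - 1)"
    using d len by (subst last_conv_nth) auto
  \<comment> \<open>The last entry of \<open>kappa\<close> is the least one, so the shift by \<open>p\<close> makes all entries nonnegative.\<close>
  have nn: "0 \<le> kappa ! i + int p" if "i < d" for i
    using dominant_nth[OF kap, of i "d - 1"] that le(2)[of "d - 1"] d by (simp add: p_def last)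
  note part = is_partition_shift_part[OF lam, of p] is_partition_shift_part[OF kap, of p]
  have "nat (kappa ! i + int p) \<le> p" if "i < d" for i using le(2)[OF that] by linarith
  then have sub: "shift_part p kappa \<le> shift_part p lam" "shift_part p kappa \<le> rect p d"
    using le by (auto simp: le_fun_def shift_part_def rect_def len intro: nat_mono)
  have "super_schur (Inl ` A0) (Inl ` A1) (shift_part p lam) (shift_part p kappa) =
      (toeplitz_minor d (super_complete (Inl ` A0) (Inl ` A1)) (beta_number (shift_part p lam)) (beta_number (shift_part p kappa))
       :: ('a + 'b, 'c) mps)"
    by (rule super_jacobi_trudi) (use A part sub len in \<open>auto simp: shift_part_def\<close>)
  also have "\<dots> = toeplitz_minor d (super_complete (Inl ` A0) (Inl ` A1)) (\<lambda>i. lam ! i - int i) (\<lambda>i. kappa ! i - int i)"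
  proof (rule minor_cong)
    fix i j assume ij: "i < d" "j < d"
    then have "0 \<le> lam ! i + int p" using nn[of i] le(1)[of i] by linarith
    then show "super_complete (Inl ` A0) (Inl ` A1) (beta_number (shift_part p lam) i - beta_number (shift_part p kappa) j) =
        super_complete (Inl ` A0) (Inl ` A1) ((lam ! i - int i) - (kappa ! j - int j))"
      using ij nn len by (intro arg_cong[of _ _ "super_complete _ _"]) (simp add: beta_number_def shift_part_def)
  qed
  finally have 1: "super_schur (Inl ` A0) (Inl ` A1) (shift_part p lam) (shift_part p kappa) =
    (toeplitz_minor d (super_complete (Inl ` A0) (Inl ` A1)) (\<lambda>i. lam ! i - int i) (\<lambda>i. kappa ! i - int i)
     :: ('a + 'b, 'c) mps)" .
  have "super_schur (Inr ` B0) (Inr ` B1) (rect p d) (shift_part p kappa) =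
      (toeplitz_minor d (super_complete (Inr ` B0) (Inr ` B1)) (beta_number (rect p d)) (beta_number (shift_part p kappa))
       :: ('a + 'b, 'c) mps)"
    by (rule super_jacobi_trudi) (use B part sub is_partition_rect in \<open>auto simp: rect_def\<close>)
  also have "\<dots> = toeplitz_minor d (super_complete (Inr ` B0) (Inr ` B1)) (\<lambda>i. - int i) (\<lambda>i. kappa ! i - int i)"
    by (rule minor_cong, rule arg_cong[of _ _ "super_complete _ _"])
       (use nn len in \<open>simp add: beta_number_def shift_part_def rect_def\<close>)
  finally show ?thesis using 1 by (simp add: SAB_term_def Let_def p_def[symmetric] len)
qed

text \<open>
  Adding back the row index matches the selections of columns in the Cauchy--Binet formula with the
  summation index \<open>kappa\<close> of \<open>SAB\<close>.
\<close>

lemma sum_dec_lists_SAB_index: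
  fixes x :: "(nat \<Rightarrow> int) \<Rightarrow> 'r::comm_monoid_add"
  assumes lam: "lam \<in> dominant d"
    and x: "\<And>g h. (\<And>i. i < d \<Longrightarrow> g i = h i) \<Longrightarrow> x g = x h"
  shows "(\<Sum>g | g \<in> dec_lists d K \<and> (\<forall>i<d. g ! i + int i \<le> min (lam ! i) 0). x ((!) g)) =
    (\<Sum>kappa | kappa \<in> SAB_index lam \<and> (\<forall>i<d. kappa ! i - int i \<in> K). x (\<lambda>i. kappa ! i - int i))"
proof (rule sum.reindex_bij_witness[of _ "\<lambda>kappa. map (\<lambda>i. kappa ! i - int i) [0..<d]"
      "\<lambda>g. map (\<lambda>i. g ! i + int i) [0..<d]"])
  have len: "length lam = d" using lam by (simp add: dominant_def)
  {
    fix g assume "g \<in> {g \<in> dec_lists d K. \<forall>i<d. g ! i + int i \<le> min (lam ! i) 0}"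
    then have g: "g \<in> dec_lists d K" and le: "\<And>i. i < d \<Longrightarrow> g ! i + int i \<le> min (lam ! i) 0" by auto
    have len_g: "length g = d" using g by (simp add: dec_lists_def)
    then show "map (\<lambda>i. map (\<lambda>i. g ! i + int i) [0..<d] ! i - int i) [0..<d] = g"
      by (intro nth_equalityI) auto
    have "map (\<lambda>i. g ! i + int i) [0..<d] \<in> dominant d"
      using dec_list_gap[OF g] by (auto simp: dominant_def sorted_wrt_iff_nth_less)
    moreover have "g ! i \<in> K" if "i < d" for i
      using g that len_g by (auto simp: dec_lists_def)
    ultimately show "map (\<lambda>i. g ! i + int i) [0..<d]
        \<in> {kappa \<in> SAB_index lam. \<forall>i<d. kappa ! i - int i \<in> K}"
      using le by (simp add: SAB_index_def len)
    show "x (\<lambda>i. map (\<lambda>i. g ! i + int i) [0..<d] ! i - int i) = x ((!) g)"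
      by (rule x) simp
  next
    fix kappa assume "kappa \<in> {kappa \<in> SAB_index lam. \<forall>i<d. kappa ! i - int i \<in> K}"
    then have kap: "kappa \<in> dominant d" and K: "\<And>i. i < d \<Longrightarrow> kappa ! i - int i \<in> K"
      and le: "\<And>i. i < d \<Longrightarrow> kappa ! i \<le> min (lam ! i) 0" by (auto simp: SAB_index_def len)
    show "map (\<lambda>i. map (\<lambda>i. kappa ! i - int i) [0..<d] ! i + int i) [0..<d] = kappa"
      using kap by (intro nth_equalityI) (auto simp: dominant_def)
    have "kappa ! j - int j < kappa ! i - int i" if "i < j" "j < d" for i j
      using dominant_nth[OF kap, of i j] that by simp
    then have "map (\<lambda>i. kappa ! i - int i) [0..<d] \<in> dec_lists d K"
      using K by (auto simp: dec_lists_def sorted_wrt_iff_nth_less)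
    then show "map (\<lambda>i. kappa ! i - int i) [0..<d]
        \<in> {g \<in> dec_lists d K. \<forall>i<d. g ! i + int i \<le> min (lam ! i) 0}"
      using le by simp
  }
qed

text \<open>
  Everything is compared at one monomial \<open>m\<close>. The matrix of the \<open>hAB\<close> is the product of the
  Toeplitz matrix of the first alphabet, with rows \<open>lam ! i - i\<close>, and the transpose of that of the
  second, with rows \<open>- i\<close>; Cauchy--Binet turns its determinant into the sum of the terms of \<open>SAB\<close>.
\<close>

theorem proposition3p17:
  fixes A0 A1 :: "'a set" and B0 B1 :: "'b set" and d :: nat and lam :: "int list"
  assumes "countable A0" and "countable A1" and "A0 \<inter> A1 = {}"
    and "countable B0" and "countable B1" and "B0 \<inter> B1 = {}"
    and "d \<ge> 1"
    and "lam \<in> dominant d"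
  shows "(SAB A0 A1 B0 B1 lam :: ('a + 'b, 'c::comm_ring_1) mps) =
    det (mat d d (\<lambda>(i, j). hAB A0 A1 B0 B1 (lam ! i - int i + int j)))"
proof (rule mps_eqI)
  fix m :: "('a + 'b) multiset"
  let ?hA = "super_complete (Inl ` A0) (Inl ` A1) :: int \<Rightarrow> ('a + 'b, 'c) mps"
  let ?hB = "super_complete (Inr ` B0) (Inr ` B1) :: int \<Rightarrow> ('a + 'b, 'c) mps"
  let ?al = "\<lambda>i. lam ! i - int i" and ?de = "\<lambda>i. - int i"
  let ?M = "\<lambda>g. toeplitz_minor d ?hA ?al g * toeplitz_minor d ?hB ?de g"
  let ?c = "\<lambda>f :: ('a + 'b, 'c) mps. mps_coeff f m"
  define F where "F = {kappa \<in> SAB_index lam. ?c (SAB_term A0 A1 B0 B1 lam kappa) \<noteq> 0}"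
  have finF: "finite F" unfolding F_def by (rule finite_SAB_terms)
  \<comment> \<open>A finite window: it contains the indices of all terms that contribute at \<open>m\<close>, and all indices
    at which the first factor of the convolution is nonzero at a divisor of \<open>m\<close>.\<close>
  define K where "K = (\<Union>kappa\<in>F. (\<lambda>i. kappa ! i - int i) ` {..<d}) \<union> (\<Union>i<d. {?al i - int (size m)..?al i})"
  have K: "finite K" using finF by (simp add: K_def)
  let ?I = "{kappa \<in> SAB_index lam. \<forall>i<d. kappa ! i - int i \<in> K}"
  have dec_al: "antimono_on {..<d} ?al" and dec_de: "antimono_on {..<d} ?de"
    using dominant_nth[OF assms(8)] by (fastforce intro!: monotone_onI)+
  have "?c (det (mat d d (\<lambda>(i, j). hAB A0 A1 B0 B1 (lam ! i - int i + int j)))) =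
      ?c (det (mat d d (\<lambda>(i, j). \<Sum>k\<in>K. ?hA (?al i - k) * ?hB (?de j - k))))"
  proof (rule agreeD, rule agree_det)
    fix i j assume "i < d" "j < d"
    then have "{?al i - int (size m)..?al i} \<subseteq> K" by (auto simp: K_def)
    then have "agree m (\<Sum>k\<in>K. ?hA (?al i - k) * ?hB (?de j - k)) (hAB A0 A1 B0 B1 (?al i - ?de j))"
      by (rule agree_hAB_convolution[OF assms(3,6) K])
    then show "agree m (hAB A0 A1 B0 B1 (lam ! i - int i + int j))
        (\<Sum>k\<in>K. ?hA (?al i - k) * ?hB (?de j - k))"
      by (simp add: agree_def)
  qed
  also have "det (mat d d (\<lambda>(i, j). \<Sum>k\<in>K. ?hA (?al i - k) * ?hB (?de j - k))) =
      (\<Sum>g\<in>dec_lists d K. ?M ((!) g))"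
  proof -
    have "det (mat d d (\<lambda>(l, j). ?hB (?de j - g ! l))) = toeplitz_minor d ?hB ?de ((!) g)" for g
    proof -
      have "mat d d (\<lambda>(l, j). ?hB (?de j - g ! l)) = transpose_mat (mat d d (\<lambda>(i, j). ?hB (?de i - g ! j)))"
        by (rule eq_matI) auto
      then show ?thesis unfolding toeplitz_minor_def by (simp add: det_transpose[of _ d])
    qed
    then show ?thesis unfolding cauchy_binet[OF K] by (simp add: toeplitz_minor_def)
  qed
  also have "\<dots> = (\<Sum>g | g \<in> dec_lists d K \<and> (\<forall>i<d. g ! i + int i \<le> min (lam ! i) 0). ?M ((!) g))"
  proof (intro sum.mono_neutral_right finite_dec_lists K ballI)
    fix g assume g: "g \<in> dec_lists d K - {g. g \<in> dec_lists d K \<and> (\<forall>i<d. g ! i + int i \<le> min (lam ! i) 0)}"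
    then obtain i where i: "i < d" "?al i < g ! i \<or> ?de i < g ! i" by force
    have dec: "antimono_on {..<d} ((!) g)" using g by (intro antimono_on_dec_list) auto
    have "toeplitz_minor d ?hA ?al ((!) g) = 0" if "?al i < g ! i"
      by (rule minor_eq_0[OF _ dec_al dec i(1) that]) simp
    moreover have "toeplitz_minor d ?hB ?de ((!) g) = 0" if "?de i < g ! i"
      by (rule minor_eq_0[OF _ dec_de dec i(1) that]) simp
    ultimately show "?M ((!) g) = 0" using i(2) by auto
  qed auto
  also have "\<dots> = (\<Sum>kappa\<in>?I. ?M (\<lambda>i. kappa ! i - int i))"
  proof (rule sum_dec_lists_SAB_index[OF assms(8)])
    fix g h :: "nat \<Rightarrow> int" assume "\<And>i. i < d \<Longrightarrow> g i = h i"
    then show "?M g = ?M h" by (intro arg_cong2[of _ _ _ _ "(*)"] minor_cong) auto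
  qed
  also have "\<dots> = (\<Sum>kappa\<in>?I. SAB_term A0 A1 B0 B1 lam kappa)"
    by (rule sum.cong) (auto simp: SAB_term_minors[OF assms])
  also have "?c \<dots> = (\<Sum>kappa\<in>?I. ?c (SAB_term A0 A1 B0 B1 lam kappa))"
    by (rule mps_coeff_sum)
  also have "\<dots> = (\<Sum>kappa\<in>F. ?c (SAB_term A0 A1 B0 B1 lam kappa))"
  proof (rule sum.mono_neutral_right)
    show "finite ?I"
    proof (rule finite_subset)
      have len: "length lam = d" using assms(8) by (simp add: dominant_def)
      let ?S = "(\<Union>i<d. (\<lambda>k. k + int i) ` K)"
      show "?I \<subseteq> {xs. set xs \<subseteq> ?S \<and> length xs = d}"
      proof (intro subsetI CollectI conjI)
        fix kappa y assume kappa: "kappa \<in> ?I" and y: "y \<in> set kappa"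
        then obtain i where "i < d" "y = kappa ! i"
          by (auto simp: in_set_conv_nth SAB_index_def dominant_def len)
        then show "y \<in> ?S" using kappa by (auto intro!: bexI[of _ i] image_eqI[of _ _ "kappa ! i - int i"])
      qed (auto simp: SAB_index_def dominant_def len)
      show "finite {xs. set xs \<subseteq> ?S \<and> length xs = d}"
        using K by (intro finite_lists_length_eq) simp
    qed
  qed (auto simp: F_def K_def)
  also have "\<dots> = ?c (SAB A0 A1 B0 B1 lam)"
    unfolding SAB_def F_def by (rule mps_coeff_suminf[OF finite_SAB_terms, symmetric])
  finally show "?c (SAB A0 A1 B0 B1 lam) =
      ?c (det (mat d d (\<lambda>(i, j). hAB A0 A1 B0 B1 (lam ! i - int i + int j))))" ..
qed

end
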